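(* Every continuous unitary representation of $\widetilde{\mathrm{SL}}_2(\mathbb R)$ extends to an (anti-)unitary representation of the graded group $\widetilde{\mathrm{GL}}_2(\mathbb R):=\widetilde{\mathrm{SL}}_2(\mathbb R)\rtimes\{\mathbf 1,\tau_G\}$, where $\tau_G$ is the involutive automorphism of $\widetilde{\mathrm{SL}}_2(\mathbb R)$ integrating the Lie algebra automorphism $\tau\begin{pmatrix}a&b\\c&d\end{pmatrix}=\begin{pmatrix}a&-b\\-c&d\end{pmatrix}$ of $\mathfrak{sl}_2(\mathbb R)$.
   Context: $\widetilde{\mathrm{SL}}_2(\mathbb R)$ is the universal covering group of $\mathrm{SL}_2(\mathbb R)$. The group $\widetilde{\mathrm{GL}}_2(\mathbb R)$ is graded with $\tau_G$ (and the coset $\widetilde{\mathrm{SL}}_2(\mathbb R)\tau_G$) of degree $-1$; an (anti-)unitary representation is a continuous homomorphism into the group of unitary and antiunitary operators on a Hilbert space sending exactly the elements of degree $-1$ to antiunitary operators. *)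

theory Defs
  imports "HOL-Analysis.Analysis"
begin

text \<open>A matrix (a b; c d) is encoded as the quadruple (a,b,c,d).
  The universal cover is realised as the set of pairs (g,t) with g in SL2(R)
  and t a complex logarithm of j(g,i) = c i + d; the map (g,t) to g is the
  covering map.  This set carries the subspace topology of R^4 x C.\<close>

type_synonym mat2 = "real \<times> real \<times> real \<times> real"
type_synonym sl2t = "mat2 \<times> complex"

fun mat2_mult :: "mat2 \<Rightarrow> mat2 \<Rightarrow> mat2" where
  "mat2_mult (a, b, c, d) (a', b', c', d') =
     (a*a' + b*c', a*b' + b*d', c*a' + d*c', c*b' + d*d')"

fun jfac :: "mat2 \<Rightarrow> complex \<Rightarrow> complex" where
  "jfac (a, b, c, d) z = complex_of_real c * z + complex_of_real d"

fun mobius2 :: "mat2 \<Rightarrow> complex \<Rightarrow> complex" where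
  "mobius2 (a, b, c, d) z =
     (complex_of_real a * z + complex_of_real b) / (complex_of_real c * z + complex_of_real d)"

definition SL2t :: "sl2t set" where
  "SL2t = {((a, b, c, d), t). a*d - b*c = 1 \<and> exp t = jfac (a, b, c, d) \<i>}"

text \<open>Group law: (g1,t1)(g2,t2) = (g1 g2, t1 + Ln(j(g1,g2 i)/j(g1,i)) + t2);
  here w \<mapsto> t1 + Ln(j(g1,w)/j(g1,i)) is the continuous branch of log j(g1,-)
  on the upper half plane taking the value t1 at i.\<close>

fun sl2t_mult :: "sl2t \<Rightarrow> sl2t \<Rightarrow> sl2t" where
  "sl2t_mult (g1, t1) (g2, t2) =
     (mat2_mult g1 g2, t1 + Ln (jfac g1 (mobius2 g2 \<i>) / jfac g1 \<i>) + t2)"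

definition sl2t_one :: sl2t where
  "sl2t_one = ((1, 0, 0, 1), 0)"

text \<open>The lift tau_G of tau(a b; c d) = (a -b; -c d): note j(tau g, i) = cnj (j(g,i)).\<close>

fun tauG :: "sl2t \<Rightarrow> sl2t" where
  "tauG ((a, b, c, d), t) = ((a, -b, -c, d), cnj t)"

text \<open>Elements (x, s): s = False means x, s = True means x tau_G (degree -1).\<close>

type_synonym gl2t = "sl2t \<times> bool"

definition GL2t :: "gl2t set" where
  "GL2t = SL2t \<times> UNIV"

fun gl2t_mult :: "gl2t \<Rightarrow> gl2t \<Rightarrow> gl2t" where
  "gl2t_mult (x, s) (y, s') = (sl2t_mult x (if s then tauG y else y), s \<noteq> s')"

definition gl2t_one :: gl2t where
  "gl2t_one = (sl2t_one, False)"

text \<open>A complex Hilbert space is modelled as a real Hilbert space 'h with a complex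
  structure I (multiplication by i): I real-linear, I o I = -id, I orthogonal.
  The real inner product is the real part of the complex one.\<close>

definition complex_structure :: "('h::real_inner \<Rightarrow> 'h) \<Rightarrow> bool" where
  "complex_structure I \<longleftrightarrow> linear I \<and> (\<forall>x. I (I x) = - x) \<and>
     (\<forall>x y. inner (I x) (I y) = inner x y)"

definition unitary_op :: "('h::real_inner \<Rightarrow> 'h) \<Rightarrow> ('h \<Rightarrow> 'h) \<Rightarrow> bool" where
  "unitary_op I U \<longleftrightarrow> linear U \<and> surj U \<and> (\<forall>x y. inner (U x) (U y) = inner x y) \<and>
     (\<forall>x. U (I x) = I (U x))"

definition antiunitary_op :: "('h::real_inner \<Rightarrow> 'h) \<Rightarrow> ('h \<Rightarrow> 'h) \<Rightarrow> bool" where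
  "antiunitary_op I U \<longleftrightarrow> linear U \<and> surj U \<and> (\<forall>x y. inner (U x) (U y) = inner x y) \<and>
     (\<forall>x. U (I x) = - I (U x))"

definition cont_unitary_rep_SL2t :: "('h::real_inner \<Rightarrow> 'h) \<Rightarrow> (sl2t \<Rightarrow> 'h \<Rightarrow> 'h) \<Rightarrow> bool" where
  "cont_unitary_rep_SL2t I V \<longleftrightarrow>
     (\<forall>x\<in>SL2t. unitary_op I (V x)) \<and>
     (\<forall>x\<in>SL2t. \<forall>y\<in>SL2t. V (sl2t_mult x y) = V x \<circ> V y) \<and>
     V sl2t_one = id \<and>
     (\<forall>v. continuous_on SL2t (\<lambda>x. V x v))"

text \<open>GL2t is the topological disjoint union of two copies of SL2t, so continuity
  means continuity on each copy.\<close>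

definition cont_au_rep_GL2t :: "('h::real_inner \<Rightarrow> 'h) \<Rightarrow> (gl2t \<Rightarrow> 'h \<Rightarrow> 'h) \<Rightarrow> bool" where
  "cont_au_rep_GL2t I U \<longleftrightarrow>
     (\<forall>x\<in>SL2t. unitary_op I (U (x, False)) \<and> antiunitary_op I (U (x, True))) \<and>
     (\<forall>p\<in>GL2t. \<forall>q\<in>GL2t. U (gl2t_mult p q) = U p \<circ> U q) \<and>
     U gl2t_one = id \<and>
     (\<forall>s v. continuous_on SL2t (\<lambda>x. U (x, s) v))"

end

theory Submission
  imports Defs
begin

text \<open>
  Call a vector z tau-symmetric if the matrix coefficient \<open>g \<mapsto> (V g z, z)\<close> is turned into its
  complex conjugate by \<open>tauG\<close>.  On the cyclic subspace of such a z the rule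
  \<open>V g z \<mapsto> V (tauG g) z\<close> defines an antiunitary involution, so by Zorn's lemma it suffices to find
  a nonzero tau-symmetric vector in every nonzero closed invariant subspace.

  Let k be the one-parameter group over SO(2).  By the Cartan decomposition G = K A K and the fact
  that the Weyl element inverts A, the vector z is tau-symmetric as soon as V (k t) z = D t z for a
  one-parameter group D of unitaries commuting with the whole representation.  To find z, cut down to
  an invariant subspace on which the central unitary V (k (2 pi)), multiplied by a suitable scalar, is
  at distance less than 1 from the identity; there it lies in a one-parameter group C defined by the
  binomial series, and V (k t) times a scalar times C (- t / (2 pi)) is 2 pi-periodic.
  A nonzero Fourier coefficient of one of its orbits is the required z.  The cutting uses the
  positive part of a bounded self-adjoint operator B, obtained from the binomial series for
  \<open>abs B = sqrt (1 - (1 - B * B))\<close>, so no spectral theorem or direct integral is needed.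
\<close>

section \<open>The group\<close>

text \<open>In an irreducible representation the centre acts by scalars, so the circle group has
  genuine eigenvectors. In general the central unitary may have continuous spectrum and
  \<open>V (rotK t)\<close> need have no eigenvector at all; this is the obstacle. The operator
  group D replaces the character of an eigenvector, and it can be handled like a scalar because it
  commutes with \<open>I\<close> and with every \<open>V g\<close>.

  For such a z the coefficient at k_s a k_t is (V a z, D (- (s + t)) z), and \<open>tauG\<close>
  only reverses the sign of s + t. That this reversal amounts to complex conjugation follows by
  passing to the adjoint of V a, which is V (a^-1), and returning to a by a quarter turn.

  Moving a scalar multiple of the central unitary close to the identity amounts to choosing a branch
  of its logarithm, and the binomial series then supplies real powers. One branch need not serve the
  whole space, but Zorn's lemma only asks for one nonzero vector in each invariant subspace, so a
  nonzero piece is enough.\<close>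

definition rotK :: "real \<Rightarrow> sl2t" where
  "rotK \<theta> = ((cos \<theta>, - sin \<theta>, sin \<theta>, cos \<theta>), \<i> * of_real \<theta>)"

definition diagA :: "real \<Rightarrow> sl2t" where
  "diagA r = ((r, 0, 0, 1 / r), - of_real (ln r))"

lemma rotK_in [simp]: "rotK \<theta> \<in> SL2t"
  by (simp add: rotK_def SL2t_def power2_eq_square[symmetric] cis_conv_exp[symmetric] complex_eq_iff)

lemma diagA_in [simp]: "r > 0 \<Longrightarrow> diagA r \<in> SL2t"
  by (simp add: diagA_def SL2t_def exp_minus exp_of_real divide_simps)

lemma jfac_nz:
  assumes "a * d - b * c = 1" "Im z > 0"
  shows "jfac (a, b, c, d) z \<noteq> 0"
proof
  assume "jfac (a, b, c, d) z = 0"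
  hence "c * Im z = 0" "c * Re z + d = 0" by (auto simp: complex_eq_iff)
  with assms show False by auto
qed

lemma Im_mobius2:
  assumes "a * d - b * c = 1"
  shows "Im (mobius2 (a, b, c, d) \<i>) > 0"
proof -
  have "c\<^sup>2 + d\<^sup>2 \<noteq> 0" using assms by (auto simp: sum_power2_eq_zero_iff)
  hence "c\<^sup>2 + d\<^sup>2 > 0" by (metis add_nonneg_nonneg less_eq_real_def zero_le_power2)
  moreover have "Im (mobius2 (a, b, c, d) \<i>) = (a * d - b * c) / (c\<^sup>2 + d\<^sup>2)"
    by (simp add: Im_divide algebra_simps)
  ultimately show ?thesis using assms by simp
qed

lemma jfac_cocycle:
  assumes "a' * d' - b' * c' = 1"
  shows "jfac (a, b, c, d) (mobius2 (a', b', c', d') \<i>) * jfac (a', b', c', d') \<i>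
    = jfac (mat2_mult (a, b, c, d) (a', b', c', d')) \<i>"
proof -
  have "of_real c' * \<i> + of_real d' \<noteq> (0::complex)"
    using jfac_nz[OF assms, of \<i>] by simp
  thus ?thesis by (simp add: field_simps)
qed

lemma sl2t_mult_in [simp]:
  assumes "x \<in> SL2t" "y \<in> SL2t"
  shows "sl2t_mult x y \<in> SL2t"
proof -
  obtain a b c d t a' b' c' d' t' where xy: "x = ((a, b, c, d), t)" "y = ((a', b', c', d'), t')"
    by (metis surj_pair)
  have det: "a * d - b * c = 1" "a' * d' - b' * c' = 1"
    and e: "exp t = jfac (a, b, c, d) \<i>" "exp t' = jfac (a', b', c', d') \<i>"
    using assms by (auto simp: xy SL2t_def)
  let ?q = "jfac (a, b, c, d) (mobius2 (a', b', c', d') \<i>)"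
  have nz: "?q \<noteq> 0" "jfac (a, b, c, d) \<i> \<noteq> 0"
    using jfac_nz[OF det(1)] Im_mobius2[OF det(2)] by (auto simp del: jfac.simps mobius2.simps)
  have "exp (t + Ln (?q / jfac (a, b, c, d) \<i>) + t') = ?q * jfac (a', b', c', d') \<i>"
    using nz by (simp add: exp_add e del: jfac.simps mobius2.simps)
  also have "\<dots> = jfac (mat2_mult (a, b, c, d) (a', b', c', d')) \<i>"
    by (rule jfac_cocycle[OF det(2)])
  finally have "exp (t + Ln (?q / jfac (a, b, c, d) \<i>) + t') = jfac (mat2_mult (a, b, c, d) (a', b', c', d')) \<i>" .
  moreover have "(a*a' + b*c') * (c*b' + d*d') - (a*b' + b*d') * (c*a' + d*c')
      = (a * d - b * c) * (a' * d' - b' * c')" by algebra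
  ultimately show ?thesis using det by (simp add: xy SL2t_def)
qed

lemma sl2t_one_in [simp]: "sl2t_one \<in> SL2t"
  by (simp add: sl2t_one_def SL2t_def)

lemma tauG_in [simp]: "x \<in> SL2t \<Longrightarrow> tauG x \<in> SL2t"
  by (cases x rule: tauG.cases) (auto simp: SL2t_def exp_cnj[symmetric])

lemma tauG_rotK [simp]: "tauG (rotK \<theta>) = rotK (- \<theta>)"
  by (simp add: rotK_def)

lemma tauG_diagA [simp]: "tauG (diagA r) = diagA r"
  by (simp add: diagA_def)

text \<open>The correction term of the group law stays off the cut of \<open>Ln\<close>, so
  \<open>Ln\<close> commutes with conjugation there. If j(g,z) = s j(g,i) with s \<le> 0, imaginary
  parts give c Im z = s c, hence c = 0, and real parts then give s = 1.\<close>

lemma jfac_ratio: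
  assumes "a * d - b * c = 1" "Im z > 0"
  shows "jfac (a, b, c, d) z / jfac (a, b, c, d) \<i> \<notin> \<real>\<^sub>\<le>\<^sub>0"
proof
  assume "jfac (a, b, c, d) z / jfac (a, b, c, d) \<i> \<in> \<real>\<^sub>\<le>\<^sub>0"
  then obtain s where s: "s \<le> 0" "jfac (a, b, c, d) z / jfac (a, b, c, d) \<i> = of_real s"
    by (elim nonpos_Reals_cases) auto
  have "jfac (a, b, c, d) \<i> \<noteq> 0" using jfac_nz[OF assms(1), of \<i>] by (simp del: jfac.simps)
  hence "jfac (a, b, c, d) z = of_real s * jfac (a, b, c, d) \<i>"
    using s(2) by (simp add: divide_eq_eq del: jfac.simps)
  hence eq: "c * Im z = s * c" "c * Re z + d = s * d" by (auto simp: complex_eq_iff)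
  have "c = 0" using eq(1) s(1) assms(2) by auto
  hence "s = 1" using eq(2) assms(1) by auto
  thus False using s by simp
qed

text \<open>On the upper half plane \<open>tauG\<close> corresponds to the reflection w -> - cnj w,
  under which the factor j is conjugated; \<open>jfac_ratio\<close> allows the logarithm to be
  conjugated too.\<close>

lemma tauG_mult:
  assumes "x \<in> SL2t" "y \<in> SL2t"
  shows "tauG (sl2t_mult x y) = sl2t_mult (tauG x) (tauG y)"
proof -
  obtain a b c d t a' b' c' d' t' where xy: "x = ((a, b, c, d), t)" "y = ((a', b', c', d'), t')"
    by (metis surj_pair)
  have det: "a * d - b * c = 1" "a' * d' - b' * c' = 1"
    using assms by (auto simp: xy SL2t_def)
  define w where "w = mobius2 (a', b', c', d') \<i>"
  have w: "mobius2 (a', - b', - c', d') \<i> = - cnj w"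
  proof -
    have "of_real c' * \<i> + of_real d' \<noteq> (0::complex)" 
      using jfac_nz[OF det(2), of \<i>] by simp
    moreover have "of_real d' - of_real c' * \<i> \<noteq> (0::complex)"
      using jfac_nz[of a' d' "- b'" "- c'" \<i>] det(2) by simp
    ultimately show ?thesis by (simp add: w_def field_simps)
  qed
  have j: "jfac (a, - b, - c, d) (- cnj z) = cnj (jfac (a, b, c, d) z)" for z by simp
  have "cnj (Ln (jfac (a, b, c, d) w / jfac (a, b, c, d) \<i>))
      = Ln (jfac (a, - b, - c, d) (- cnj w) / jfac (a, - b, - c, d) \<i>)"
    using cnj_Ln[OF jfac_ratio[OF det(1) Im_mobius2[OF det(2)]]] j[of w] j[of \<i>]
    by (simp add: w_def del: jfac.simps mobius2.simps)
  thus ?thesis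
    by (simp add: xy w w_def[symmetric] del: jfac.simps mobius2.simps)
qed

lemma mobius2_rotK: "mobius2 (cos \<theta>, - sin \<theta>, sin \<theta>, cos \<theta>) \<i> = \<i>"
proof -
  have "of_real (sin \<theta>) * \<i> + of_real (cos \<theta>) \<noteq> (0::complex)"
    using jfac_nz[of "cos \<theta>" "cos \<theta>" "- sin \<theta>" "sin \<theta>" \<i>] by (simp add: power2_eq_square[symmetric])
  thus ?thesis by (simp add: field_simps)
qed

text \<open>Rotations fix the point i, so the correction term is Ln 1 = 0.\<close>

lemma mult_rotK:
  assumes "(g, t) \<in> SL2t"
  shows "sl2t_mult (g, t) (rotK \<theta>) = (mat2_mult g (fst (rotK \<theta>)), t + \<i> * of_real \<theta>)"
proof -
  obtain a b c d where g: "g = (a, b, c, d)" by (metis surj_pair)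
  have "jfac g \<i> \<noteq> 0" using jfac_nz[of a d b c \<i>] assms by (simp add: g SL2t_def)
  thus ?thesis by (simp add: rotK_def mobius2_rotK del: mobius2.simps)
qed

lemma rotK_mult_rotK: "sl2t_mult (rotK \<theta>) (rotK \<phi>) = rotK (\<theta> + \<phi>)"
proof -
  have "(fst (rotK \<theta>), snd (rotK \<theta>)) \<in> SL2t" by (simp del: prod.collapse add: prod.collapse)
  from mult_rotK[OF this, of \<phi>] show ?thesis
    by (simp add: rotK_def cos_add sin_add algebra_simps)
qed

lemma rotK_0: "rotK 0 = sl2t_one"
  by (simp add: rotK_def sl2t_one_def)

text \<open>\<open>rotK (2 * pi)\<close> lies over the identity matrix with logarithm 2 pi i, so it
  generates the kernel of the covering map. Its factor j is constantly 1, so the correction vanishes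
  on either side.\<close>

lemma rotK_central:
  assumes "x \<in> SL2t"
  shows "sl2t_mult x (rotK (2 * pi)) = sl2t_mult (rotK (2 * pi)) x"
proof -
  obtain a b c d t where x: "x = ((a, b, c, d), t)" by (metis surj_pair)
  show ?thesis using mult_rotK[of "(a, b, c, d)" t "2 * pi"] assms
    by (simp add: x rotK_def)
qed

text \<open>More than a matrix identity: the sheet must be right as well. The two quarter turns
  cancel in the logarithm, and since the left factor has j(k,w) = w, the correction is Ln (r^2),
  which turns - ln r into ln r.\<close>

lemma rotK_diagA_conj:
  assumes "r > 0"
  shows "sl2t_mult (rotK (pi / 2)) (sl2t_mult (diagA r) (rotK (- pi / 2))) = diagA (1 / r)"
proof -
  have "(fst (diagA r), snd (diagA r)) \<in> SL2t" using assms by (simp del: prod.collapse add: prod.collapse)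
  from mult_rotK[OF this, of "- pi / 2"] 
  have *: "sl2t_mult (diagA r) (rotK (- pi / 2)) = ((0, r, - 1 / r, 0), - of_real (ln r) - \<i> * of_real pi / 2)"
    by (simp add: diagA_def rotK_def)
  have m: "mobius2 (0, r, - 1 / r, 0) \<i> = of_real (r\<^sup>2) * \<i>"
    using assms by (simp add: field_simps power2_eq_square)
  have "Ln (of_real (r\<^sup>2)) = of_real (2 * ln r)"
    using assms by (simp add: Ln_of_real ln_realpow del: of_real_power)
  thus ?thesis using assms
    by (simp add: * m diagA_def ln_div del: mobius2.simps) (simp add: rotK_def power2_eq_square)
qed

lemma diagA_inverse:
  assumes "r > 0"
  shows "sl2t_mult (diagA (1 / r)) (diagA r) = sl2t_one"
  using assms by (simp add: diagA_def sl2t_one_def ln_div)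

section \<open>The Cartan decomposition, for matrices and on the cover\<close>

lemma orthogonal_rows:
  fixes a b c d :: real
  assumes det: "a * d - b * c = 1" and orth: "a * c + b * d = 0"
  shows "\<exists>r \<phi>. r > 0 \<and> a = r * cos \<phi> \<and> b = - r * sin \<phi> \<and> c = sin \<phi> / r \<and> d = cos \<phi> / r"
proof -
  define r where "r = sqrt (a\<^sup>2 + b\<^sup>2)"
  have "a\<^sup>2 + b\<^sup>2 \<noteq> 0" using det by (auto simp: sum_power2_eq_zero_iff)
  hence pos: "a\<^sup>2 + b\<^sup>2 > 0" by (metis add_nonneg_nonneg less_eq_real_def zero_le_power2)
  hence r: "r > 0" "r\<^sup>2 = a\<^sup>2 + b\<^sup>2" by (auto simp: r_def)
  have "(a / r)\<^sup>2 + (- b / r)\<^sup>2 = 1"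
    using r by (simp add: power_divide add_divide_distrib[symmetric] flip: r(2))
  then obtain \<phi> where \<phi>: "a / r = cos \<phi>" "- b / r = sin \<phi>" by (metis sincos_total_2pi)
  \<comment> \<open>Solving the linear system given by \<open>det\<close> and \<open>orth\<close>:
    the second row is the first one turned by a right angle and divided by r^2.\<close>
  have "r\<^sup>2 * d = a"
  proof -
    have "(a\<^sup>2 + b\<^sup>2) * d = a * (a * d - b * c) + b * (a * c + b * d)" by algebra
    thus ?thesis using det orth r by simp
  qed
  moreover have "r\<^sup>2 * c = - b"
  proof -
    have "(a\<^sup>2 + b\<^sup>2) * c = a * (a * c + b * d) - b * (a * d - b * c)" by algebra
    thus ?thesis using det orth r by simp
  qed
  ultimately have "c = (- b / r) / r" "d = (a / r) / r"
    using r(1) by (auto simp: field_simps power2_eq_square)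
  hence "c = sin \<phi> / r" "d = cos \<phi> / r" unfolding \<phi> by auto
  moreover have "a = r * cos \<phi>" "b = - r * sin \<phi>" using \<phi> r(1) by (auto simp: field_simps)
  ultimately show ?thesis using r(1) by blast
qed

lemma SL2_KAK:
  fixes a b c d :: real
  assumes det: "a * d - b * c = 1"
  shows "\<exists>\<theta> r \<phi>. r > 0 \<and>
    (a, b, c, d) = mat2_mult (fst (rotK \<theta>)) (mat2_mult (r, 0, 0, 1 / r) (fst (rotK \<phi>)))"
proof -
  \<comment> \<open>The inner product of the two rows after left multiplication by the rotation
    through - \<theta>. A quarter turn exchanges the rows up to a sign, so the value at pi/2 is the
    negative of the value at 0.\<close>
  define f where "f \<theta> = (cos \<theta> * a + sin \<theta> * c) * (cos \<theta> * c - sin \<theta> * a)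
    + (cos \<theta> * b + sin \<theta> * d) * (cos \<theta> * d - sin \<theta> * b)" for \<theta>
  have cont: "continuous_on {0..pi/2} f" unfolding f_def by (intro continuous_intros)
  have f0: "f 0 = a * c + b * d" "f (pi/2) = - (a * c + b * d)" by (auto simp: f_def algebra_simps)
  have "\<exists>\<theta>. f \<theta> = 0"
  proof (cases "f 0 \<le> 0")
    case True
    thus ?thesis using IVT'[of f 0 0 "pi/2"] cont f0 by auto
  next
    case False
    thus ?thesis using IVT2'[of f "pi/2" 0 0] cont f0 by auto
  qed
  then obtain \<theta> where th: "f \<theta> = 0" ..
  let ?C = "cos \<theta>" and ?S = "sin \<theta>"
  have cs: "?C * ?C + ?S * ?S = 1" by (metis power2_eq_square sin_cos_squared_add2)
  have "(?C * a + ?S * c) * (?C * d - ?S * b) - (?C * b + ?S * d) * (?C * c - ?S * a)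
      = (?C * ?C + ?S * ?S) * (a * d - b * c)" by algebra
  hence "(?C * a + ?S * c) * (?C * d - ?S * b) - (?C * b + ?S * d) * (?C * c - ?S * a) = 1"
    using cs det by simp
  from orthogonal_rows[OF this] th obtain r \<phi> where r: "r > 0" and
    e: "?C * a + ?S * c = r * cos \<phi>" "?C * b + ?S * d = - r * sin \<phi>"
       "?C * c - ?S * a = sin \<phi> / r" "?C * d - ?S * b = cos \<phi> / r"
    unfolding f_def by blast
  have "a = ?C * (?C * a + ?S * c) - ?S * (?C * c - ?S * a)"
       "b = ?C * (?C * b + ?S * d) - ?S * (?C * d - ?S * b)"
       "c = ?S * (?C * a + ?S * c) + ?C * (?C * c - ?S * a)"
       "d = ?S * (?C * b + ?S * d) + ?C * (?C * d - ?S * b)"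
    using cs by algebra+
  hence "a = ?C * (r * cos \<phi>) - ?S * (sin \<phi> / r)" "b = ?C * (- r * sin \<phi>) - ?S * (cos \<phi> / r)"
        "c = ?S * (r * cos \<phi>) + ?C * (sin \<phi> / r)" "d = ?S * (- r * sin \<phi>) + ?C * (cos \<phi> / r)"
    unfolding e by auto
  thus ?thesis using r
    by - (rule exI[of _ \<theta>], rule exI[of _ r], rule exI[of _ \<phi>], auto simp: rotK_def)
qed

lemma SL2t_KAK:
  assumes "x \<in> SL2t"
  obtains \<theta> r \<phi> where "r > 0" "x = sl2t_mult (rotK \<theta>) (sl2t_mult (diagA r) (rotK \<phi>))"
proof -
  obtain a b c d t where x: "x = ((a, b, c, d), t)" by (metis surj_pair)
  have det: "a * d - b * c = 1" and et: "exp t = jfac (a, b, c, d) \<i>"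
    using assms by (auto simp: x SL2t_def)
  from SL2_KAK[OF det] obtain \<theta> r \<phi> where r: "r > 0" and
    g: "(a, b, c, d) = mat2_mult (fst (rotK \<theta>)) (mat2_mult (r, 0, 0, 1 / r) (fst (rotK \<phi>)))" by blast
  have dA: "(fst (diagA r), snd (diagA r)) \<in> SL2t" using r by (simp del: prod.collapse add: prod.collapse)
  have inner: "sl2t_mult (diagA r) (rotK \<psi>)
      = (mat2_mult (r, 0, 0, 1 / r) (fst (rotK \<psi>)), - of_real (ln r) + \<i> * of_real \<psi>)" for \<psi>
    using mult_rotK[OF dA, of \<psi>] by (simp add: diagA_def)
  define y where "y \<psi> = sl2t_mult (rotK \<theta>) (sl2t_mult (diagA r) (rotK \<psi>))" for \<psi>
  have y_in: "y \<psi> \<in> SL2t" for \<psi> using r by (simp add: y_def)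
  have fst_y: "fst (y \<phi>) = (a, b, c, d)"
    unfolding y_def g by (subst inner) (simp add: rotK_def)
  \<comment> \<open>A full turn of the last angle is invisible in the matrix but adds 2 pi i to the
    logarithm; this is the freedom needed to reach the given sheet.\<close>
  have shift: "y (\<phi> + 2 * real_of_int n * pi) = (fst (y \<phi>), snd (y \<phi>) + of_real (2 * real_of_int n * pi) * \<i>)" for n
  proof -
    have "sin (\<phi> + 2 * real_of_int n * pi) = sin \<phi>" "cos (\<phi> + 2 * real_of_int n * pi) = cos \<phi>"
      using sin_int_2pin[of n] cos_int_2pin[of n] by (auto simp: sin_add cos_add mult_ac)
    thus ?thesis unfolding y_def inner by (simp add: rotK_def algebra_simps)
  qed
  have "exp (snd (y \<phi>)) = jfac (fst (y \<phi>)) \<i>"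
    using y_in[of \<phi>] by (auto simp: SL2t_def)
  hence "exp t = exp (snd (y \<phi>))" using et fst_y by simp
  then obtain n :: int where "t = snd (y \<phi>) + of_int (2 * n) * of_real pi * \<i>"
    by (auto simp: exp_eq)
  hence "x = y (\<phi> + 2 * real_of_int n * pi)"
    using shift[of n] fst_y by (simp add: x)
  thus thesis using that r unfolding y_def by blast
qed

lemma continuous_on_rotK: "continuous_on A rotK"
  unfolding rotK_def by (intro continuous_intros)

section \<open>Projections and isometries\<close>

lemma closure_subspace_normed:
  fixes S :: "'a::real_normed_vector set"
  assumes "subspace S" shows "subspace (closure S)"
proof (rule subspaceI)
  show "0 \<in> closure S" using subspace_0[OF assms] closure_subset by blast
next
  fix x y assume "x \<in> closure S" "y \<in> closure S"
  then obtain f g where fg: "\<And>n::nat. f n \<in> S" "f \<longlonglongrightarrow> x" "\<And>n::nat. g n \<in> S" "g \<longlonglongrightarrow> y"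
    unfolding closure_sequential by blast
  have "(\<lambda>n. f n + g n) \<longlonglongrightarrow> x + y" by (intro tendsto_intros fg)
  thus "x + y \<in> closure S" unfolding closure_sequential
    by (intro exI[of _ "\<lambda>n. f n + g n"]) (auto intro: subspace_add[OF assms] fg)
next
  fix c x assume "x \<in> closure S"
  then obtain f where f: "\<And>n::nat. f n \<in> S" "f \<longlonglongrightarrow> x" unfolding closure_sequential by blast
  have "(\<lambda>n. c *\<^sub>R f n) \<longlonglongrightarrow> c *\<^sub>R x" by (intro tendsto_intros f)
  thus "c *\<^sub>R x \<in> closure S" unfolding closure_sequential
    by (intro exI[of _ "\<lambda>n. c *\<^sub>R f n"]) (auto intro: subspace_scale[OF assms] f)
qed

lemma closed_subspace_nearest:
  fixes S :: "'a::{real_inner, complete_space} set"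
  assumes S: "subspace S" "closed S"
  shows "\<exists>p\<in>S. \<forall>y\<in>S. inner (x - p) y = 0"
proof -
  define d where "d = Inf ((\<lambda>y. (norm (x - y))\<^sup>2) ` S)"
  have bdd: "bdd_below ((\<lambda>y. (norm (x - y))\<^sup>2) ` S)"
    by (rule bdd_belowI[of _ 0]) auto
  have ne: "(\<lambda>y. (norm (x - y))\<^sup>2) ` S \<noteq> {}" using subspace_0[OF S(1)] by auto
  have d_le: "d \<le> (norm (x - y))\<^sup>2" if "y \<in> S" for y
    unfolding d_def using bdd that by (auto intro: cInf_lower)
  have "\<exists>y\<in>S. (norm (x - y))\<^sup>2 < d + 1 / real (Suc n)" for n
  proof -
    have "d < d + 1 / real (Suc n)" by simp
    thus ?thesis unfolding d_def cInf_less_iff[OF ne bdd] by auto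
  qed
  then obtain f where f: "\<And>n. f n \<in> S" "\<And>n. (norm (x - f n))\<^sup>2 < d + 1 / real (Suc n)" by metis
  \<comment> \<open>Parallelogram law: the midpoint of two near-minimisers lies in S and is no
    closer to x than the infimum, which forces the two points together.\<close>
  have par: "(norm (f m - f n))\<^sup>2 \<le> 2 / real (Suc m) + 2 / real (Suc n)" for m n
  proof -
    have "(1/2) *\<^sub>R (f m + f n) \<in> S" by (intro subspace_scale subspace_add S f)
    hence "d \<le> (norm (x - (1/2) *\<^sub>R (f m + f n)))\<^sup>2" by (rule d_le)
    moreover have "(norm (f m - f n))\<^sup>2 + 4 * (norm (x - (1/2) *\<^sub>R (f m + f n)))\<^sup>2
        = 2 * (norm (x - f m))\<^sup>2 + 2 * (norm (x - f n))\<^sup>2"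
      by (simp add: power2_norm_eq_inner inner_diff_left inner_diff_right inner_add_left inner_add_right
          inner_commute algebra_simps)
    ultimately show ?thesis using f(2)[of m] f(2)[of n] by auto
  qed
  have "Cauchy f"
  proof (rule CauchyI)
    fix e :: real assume e: "e > 0"
    obtain N where N: "4 / e\<^sup>2 < real N" using reals_Archimedean2 by blast
    have "norm (f m - f n) < e" if "m \<ge> N" "n \<ge> N" for m n
    proof -
      have "4 / e\<^sup>2 < real (Suc m)" "4 / e\<^sup>2 < real (Suc n)" using N that by auto
      hence "2 / real (Suc m) < e\<^sup>2 / 2" "2 / real (Suc n) < e\<^sup>2 / 2"
        using e by (auto simp: field_simps)
      hence "(norm (f m - f n))\<^sup>2 < e\<^sup>2" using par[of m n] by linarith
      thus ?thesis using e by (intro power2_less_imp_less[of _ e]) auto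
    qed
    thus "\<exists>M. \<forall>m\<ge>M. \<forall>n\<ge>M. norm (f m - f n) < e" by blast
  qed
  then obtain p where p: "f \<longlonglongrightarrow> p" using Cauchy_convergent convergent_def by blast
  have pS: "p \<in> S" using closed_sequentially[OF S(2)] f(1) p by blast
  have "(\<lambda>n. (norm (x - f n))\<^sup>2) \<longlonglongrightarrow> (norm (x - p))\<^sup>2" by (intro tendsto_intros p)
  moreover have "(\<lambda>n. d + 1 / real (Suc n)) \<longlonglongrightarrow> d + 0"
    by (intro tendsto_intros LIMSEQ_inverse_real_of_nat[unfolded inverse_eq_divide])
  ultimately have "(norm (x - p))\<^sup>2 \<le> d + 0"
    using f(2) by (intro LIMSEQ_le) (auto intro: less_imp_le)
  hence min: "(norm (x - p))\<^sup>2 \<le> (norm (x - y))\<^sup>2" if "y \<in> S" for y using d_le[OF that] by linarith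
  have "inner (x - p) y = 0" if y: "y \<in> S" for y
  proof (cases "y = 0")
    case False
    \<comment> \<open>The minimiser of the quadratic polynomial obtained by moving p along
      y.\<close>
    define t where "t = inner (x - p) y / inner y y"
    have "p + t *\<^sub>R y \<in> S" by (intro subspace_add subspace_scale S pS y)
    from min[OF this] have "(norm (x - p))\<^sup>2 \<le> (norm (x - p - t *\<^sub>R y))\<^sup>2" by (simp add: diff_diff_eq)
    also have "\<dots> = (norm (x - p))\<^sup>2 - 2 * t * inner (x - p) y + t\<^sup>2 * inner y y" (is "?L = ?R")
    proof -
      have "inner (u - t *\<^sub>R y) (u - t *\<^sub>R y) = inner u u - 2 * t * inner u y + t\<^sup>2 * inner y y" for u
        by (simp add: inner_diff_left inner_diff_right inner_commute power2_eq_square)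
      thus ?thesis by (simp only: power2_norm_eq_inner)
    qed
    finally have "0 \<le> - 2 * t * inner (x - p) y + t\<^sup>2 * inner y y" by simp
    also have "\<dots> = - (inner (x - p) y)\<^sup>2 / inner y y"
      using False by (simp add: t_def power2_eq_square field_simps)
    finally have "(inner (x - p) y)\<^sup>2 / inner y y \<le> 0" by simp
    moreover have "inner y y > 0" using False by simp
    ultimately have "(inner (x - p) y)\<^sup>2 \<le> 0" by (simp add: divide_le_0_iff)
    thus ?thesis by simp
  qed simp
  thus ?thesis using pS by blast
qed

lemma orthogonal_projection:
  fixes S :: "'a::{real_inner, complete_space} set"
  assumes S: "subspace S" "closed S"
  obtains P where "linear P" "\<And>x. P x \<in> S" "\<And>x y. y \<in> S \<Longrightarrow> inner (x - P x) y = 0"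
    "\<And>x. x \<in> S \<Longrightarrow> P x = x" "\<And>x y. inner (P x) y = inner x (P y)" "\<And>x. norm (P x) \<le> norm x"
    "\<And>x p. p \<in> S \<Longrightarrow> (\<And>y. y \<in> S \<Longrightarrow> inner (x - p) y = 0) \<Longrightarrow> P x = p"
proof -
  obtain P where P: "\<And>x. P x \<in> S" "\<And>x y. y \<in> S \<Longrightarrow> inner (x - P x) y = 0"
    using closed_subspace_nearest[OF S] by metis
  have uniq: "P x = p" if "p \<in> S" "\<And>y. y \<in> S \<Longrightarrow> inner (x - p) y = 0" for x p
  proof -
    have mem: "P x - p \<in> S" by (intro subspace_diff S P that)
    have "inner (P x - p) (P x - p) = inner (x - p) (P x - p) - inner (x - P x) (P x - p)"
      by (simp add: inner_diff_left)
    also have "\<dots> = 0" using P(2)[OF mem] that(2)[OF mem] by simp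
    finally show ?thesis by simp
  qed
  have lin: "linear P"
  proof (rule linearI)
    fix x y show "P (x + y) = P x + P y"
    proof (rule uniq)
      fix z assume "z \<in> S"
      thus "inner (x + y - (P x + P y)) z = 0"
        using P(2)[of z x] P(2)[of z y] by (simp add: inner_diff_left inner_add_left)
    qed (intro subspace_add S P)
  next
    fix c x show "P (c *\<^sub>R x) = c *\<^sub>R P x"
    proof (rule uniq)
      fix z assume "z \<in> S"
      thus "inner (c *\<^sub>R x - c *\<^sub>R P x) z = 0"
        using P(2)[of z x] by (simp add: inner_diff_left)
    qed (intro subspace_scale S P)
  qed
  have sym: "inner (P x) y = inner x (P y)" for x y
    using P(2)[OF P(1)[of y], of x] P(2)[OF P(1)[of x], of y]
    by (simp add: inner_diff_left inner_diff_right) (metis inner_commute)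
  have "norm (P x) \<le> norm x" for x
  proof -
    have "(norm (P x))\<^sup>2 = inner (P x) x"
      using sym[of x "P x"] uniq[of "P x" "P x"] P(1)[of x] P(2)[OF P(1)[of x], of x]
      by (simp add: inner_diff_left power2_norm_eq_inner) (metis inner_commute)
    also have "\<dots> \<le> norm (P x) * norm x" by (rule norm_cauchy_schwarz)
    finally show ?thesis by (cases "P x = 0") (auto simp: power2_eq_square)
  qed
  moreover have "P x = x" if "x \<in> S" for x using that by (intro uniq) auto
  ultimately show thesis by (intro that[of P] lin P sym uniq) simp_all
qed

text \<open>\<open>U (P x)\<close> has the characterising property of the projection of
  \<open>U x\<close>: the error U (x - P x) is orthogonal to S because the adjoint \<open>U'\<close>
  preserves S.\<close>

lemma projection_commute:
  fixes U :: "'a::{real_inner, complete_space} \<Rightarrow> 'a"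
  assumes "linear U" "\<And>x. x \<in> S \<Longrightarrow> U x \<in> S" "\<And>x. x \<in> S \<Longrightarrow> U' x \<in> S"
    and adj: "\<And>x y. inner (U x) y = inner x (U' y)"
    and P: "\<And>x. P x \<in> S" "\<And>x y. y \<in> S \<Longrightarrow> inner (x - P x) y = 0"
    "\<And>x p. p \<in> S \<Longrightarrow> (\<And>y. y \<in> S \<Longrightarrow> inner (x - p) y = 0) \<Longrightarrow> P x = p"
  shows "P (U x) = U (P x)"
proof (rule P(3))
  fix y assume "y \<in> S"
  thus "inner (U x - U (P x)) y = 0"
    using P(2)[OF assms(3), of y x] by (simp add: linear_diff[OF assms(1), symmetric] adj)
qed (intro assms P)

text \<open>The isometry is built as a graph. On the span of the pairs (e a, f a) both coordinates
  have equal norm because the Gram matrices agree. This survives closure, so the closed subspace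
  \<open>C\<close> is single-valued, and density together with completeness makes its domain
  everything.\<close>

lemma isometry_extension:
  fixes e f :: "'i \<Rightarrow> 'a::{real_inner, complete_space}"
  assumes inner_eq: "\<And>a b. inner (e a) (e b) = inner (f a) (f b)"
    and dense: "closure (span (range e)) = UNIV"
  obtains J where "linear J" "\<And>x y. inner (J x) (J y) = inner x y" "\<And>a. J (e a) = f a"
proof -
  define G where "G = span (range (\<lambda>a. (e a, f a)))"
  define C where "C = closure G"
  have sub: "subspace G" "subspace C" unfolding C_def G_def
    by (auto intro!: closure_subspace_normed)
  have G_inner: "inner (fst p) (fst q) = inner (snd p) (snd q)" if "p \<in> G" "q \<in> G" for p q
  proof -
    have 1: "inner (fst p) (e b) = inner (snd p) (f b)" for b
      using \<open>p \<in> G\<close> unfolding G_def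
      by (induction rule: span_induct_alt) (auto simp: inner_add_left inner_eq)
    show ?thesis
      using \<open>q \<in> G\<close> unfolding G_def
      by (induction rule: span_induct_alt) (auto simp: inner_add_right 1)
  qed
  have G_norm: "norm (fst p) = norm (snd p)" if "p \<in> G" for p
    using G_inner[OF that that] by (simp add: norm_eq_sqrt_inner)
  have C_norm: "norm (fst p) = norm (snd p)" if pC: "p \<in> C" for p
  proof -
    obtain h where h: "\<And>n::nat. h n \<in> G" "h \<longlonglongrightarrow> p"
      using pC unfolding C_def closure_sequential by blast
    have "(\<lambda>n. norm (fst (h n))) \<longlonglongrightarrow> norm (fst p)" "(\<lambda>n. norm (snd (h n))) \<longlonglongrightarrow> norm (snd p)"
      by (intro tendsto_intros h)+
    thus ?thesis using G_norm[OF h(1)] LIMSEQ_unique by force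
  qed
  have ex: "\<exists>y. (x, y) \<in> C" for x
  proof -
    have "x \<in> closure (span (range e))" using dense by simp
    then obtain s where s: "\<And>n::nat. s n \<in> span (range e)" "s \<longlonglongrightarrow> x"
      unfolding closure_sequential by blast
    have span_G: "\<exists>y. (u, y) \<in> G" if "u \<in> span (range e)" for u
      using that
    proof (induction rule: span_induct_alt)
      case base
      show ?case using subspace_0[OF sub(1)] by (auto simp: zero_prod_def)
    next
      case (step c v w)
      then obtain y a where y: "(w, y) \<in> G" "v = e a" by auto
      have "(e a, f a) \<in> G" unfolding G_def by (rule span_base) auto
      hence "c *\<^sub>R (e a, f a) + (w, y) \<in> G" by (intro subspace_add subspace_scale sub y)
      thus ?case using y by auto
    qed
    have "\<forall>n. \<exists>y. (s n, y) \<in> G" using span_G[OF s(1)] by blast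
    then obtain t where t: "\<And>n. (s n, t n) \<in> G" by metis
    have "norm (t m - t n) = norm (s m - s n)" for m n
      using G_norm[OF subspace_diff[OF sub(1) t t], of m n] by simp
    hence "Cauchy t" using LIMSEQ_imp_Cauchy[OF s(2)] by (simp add: Cauchy_def dist_norm)
    then obtain y where "t \<longlonglongrightarrow> y" using Cauchy_convergent convergent_def by blast
    hence "(\<lambda>n. (s n, t n)) \<longlonglongrightarrow> (x, y)" by (intro tendsto_intros s)
    thus ?thesis using t unfolding C_def closure_sequential
      by (intro exI[of _ y] exI[of _ "\<lambda>n. (s n, t n)"]) auto
  qed
  have uniq: "y = y'" if "(x, y) \<in> C" "(x, y') \<in> C" for x y y'
    using C_norm[OF subspace_diff[OF sub(2) that]] by simp
  obtain J where J: "\<And>x. (x, J x) \<in> C" using ex by metis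
  have lin: "linear J"
  proof (rule linearI)
    fix x y show "J (x + y) = J x + J y"
      using subspace_add[OF sub(2) J[of x] J[of y]] by (intro uniq[OF J]) simp
  next
    fix c x show "J (c *\<^sub>R x) = c *\<^sub>R J x"
      using subspace_scale[OF sub(2) J[of x], of c] by (intro uniq[OF J]) simp
  qed
  have nJ: "norm (J x) = norm x" for x using C_norm[OF J[of x]] by simp
  have "inner (J x) (J y) = inner x y" for x y
    using nJ[of "x + y"] nJ[of x] nJ[of y]
    by (simp add: linear_add[OF lin] dot_norm)
  moreover have "J (e a) = f a" for a
  proof (rule uniq[OF J])
    have "(e a, f a) \<in> G" unfolding G_def by (rule span_base) auto
    thus "(e a, f a) \<in> C" unfolding C_def using closure_subset by blast
  qed
  ultimately show thesis using that lin by blast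
qed

section \<open>Power series in a bounded operator\<close>

definition opser :: "(nat \<Rightarrow> real) \<Rightarrow> ('a \<Rightarrow> 'a) \<Rightarrow> 'a \<Rightarrow> 'a::{real_inner, banach}" where
  "opser a X x = (\<Sum>n. a n *\<^sub>R (X ^^ n) x)"

definition bounded_by :: "real \<Rightarrow> ('a \<Rightarrow> 'a::real_normed_vector) \<Rightarrow> bool" where
  "bounded_by r X \<longleftrightarrow> linear X \<and> 0 \<le> r \<and> (\<forall>x. norm (X x) \<le> r * norm x)"

lemma bounded_by_linear: "bounded_by r X \<Longrightarrow> linear X"
  by (simp add: bounded_by_def)

lemma bounded_by_bounded_linear: "bounded_by r X \<Longrightarrow> bounded_linear X"
  unfolding bounded_by_def by (auto intro!: bounded_linear_intro[where K = r]
    simp: linear_add linear_cmul mult.commute)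

lemma linear_funpow:
  fixes X :: "'a::real_vector \<Rightarrow> 'a"
  shows "linear X \<Longrightarrow> linear (X ^^ n)"
  by (induction n) (auto simp: linear_iff)

lemma norm_funpow_le:
  assumes "bounded_by r X" shows "norm ((X ^^ n) x) \<le> r ^ n * norm x"
proof (induction n)
  case (Suc n)
  have "norm ((X ^^ Suc n) x) \<le> r * norm ((X ^^ n) x)" using assms by (simp add: bounded_by_def)
  also have "\<dots> \<le> r * (r ^ n * norm x)" using Suc assms by (intro mult_left_mono) (auto simp: bounded_by_def)
  finally show ?case by (simp add: mult.assoc)
qed simp

lemma opser_norm_bound:
  assumes "bounded_by r X" shows "norm (a n *\<^sub>R (X ^^ n) x) \<le> (\<bar>a n\<bar> * r ^ n) * norm x"
  using mult_left_mono[OF norm_funpow_le[OF assms, of n x], of "\<bar>a n\<bar>"] by (simp add: mult.assoc)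

lemma opser_summable:
  fixes X :: "'a \<Rightarrow> 'a::{real_inner, banach}"
  assumes "bounded_by r X" "summable (\<lambda>n. \<bar>a n\<bar> * r ^ n)"
  shows "summable (\<lambda>n. norm (a n *\<^sub>R (X ^^ n) x))" "summable (\<lambda>n. a n *\<^sub>R (X ^^ n) x)"
proof -
  show "summable (\<lambda>n. norm (a n *\<^sub>R (X ^^ n) x))"
    by (rule summable_comparison_test'[OF summable_mult2[OF assms(2), of "norm x"]])
       (use opser_norm_bound[OF assms(1)] in auto)
  thus "summable (\<lambda>n. a n *\<^sub>R (X ^^ n) x)" by (rule summable_norm_cancel)
qed

lemma opser_sums:
  assumes "bounded_by r X" "summable (\<lambda>n. \<bar>a n\<bar> * r ^ n)"
  shows "(\<lambda>n. a n *\<^sub>R (X ^^ n) x) sums opser a X x"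
  unfolding opser_def by (rule summable_sums[OF opser_summable(2)[OF assms]])

lemma opser_bounded_by:
  assumes "bounded_by r X" "summable (\<lambda>n. \<bar>a n\<bar> * r ^ n)"
  shows "bounded_by (\<Sum>n. \<bar>a n\<bar> * r ^ n) (opser a X)"
  unfolding bounded_by_def
proof (intro conjI allI)
  note lin = linear_funpow[OF bounded_by_linear[OF assms(1)]]
  show "linear (opser a X)"
  proof (rule linearI)
    fix x y
    have "(\<lambda>n. a n *\<^sub>R (X ^^ n) (x + y)) sums (opser a X x + opser a X y)"
      using sums_add[OF opser_sums[OF assms] opser_sums[OF assms], of x y]
      by (simp add: linear_add[OF lin] scaleR_add_right)
    thus "opser a X (x + y) = opser a X x + opser a X y"
      using sums_unique2 opser_sums[OF assms] by blast
  next
    fix c x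
    have "(\<lambda>n. c *\<^sub>R (a n *\<^sub>R (X ^^ n) x)) sums (c *\<^sub>R opser a X x)"
      by (rule sums_scaleR_right[OF opser_sums[OF assms]])
    hence "(\<lambda>n. a n *\<^sub>R (X ^^ n) (c *\<^sub>R x)) sums (c *\<^sub>R opser a X x)"
      by (simp add: linear_cmul[OF lin] mult.commute)
    thus "opser a X (c *\<^sub>R x) = c *\<^sub>R opser a X x"
      using sums_unique2 opser_sums[OF assms] by blast
  qed
  show "0 \<le> (\<Sum>n. \<bar>a n\<bar> * r ^ n)"
    using assms by (intro suminf_nonneg) (auto simp: bounded_by_def)
  fix x
  have "norm (opser a X x) \<le> (\<Sum>n. norm (a n *\<^sub>R (X ^^ n) x))"
    unfolding opser_def by (rule summable_norm[OF opser_summable(1)[OF assms]])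
  also have "\<dots> \<le> (\<Sum>n. (\<bar>a n\<bar> * r ^ n) * norm x)"
    by (intro suminf_le opser_summable[OF assms] opser_norm_bound[OF assms(1)] summable_mult2 assms)
  also have "\<dots> = (\<Sum>n. \<bar>a n\<bar> * r ^ n) * norm x"
    by (rule suminf_mult2[OF assms(2), symmetric])
  finally show "norm (opser a X x) \<le> (\<Sum>n. \<bar>a n\<bar> * r ^ n) * norm x" .
qed

lemma opser_linear:
  assumes "bounded_by r X" "summable (\<lambda>n. \<bar>a n\<bar> * r ^ n)"
  shows "linear (opser a X)"
  using opser_bounded_by[OF assms] by (rule bounded_by_linear)

lemma funpow_commute_at:
  assumes "\<And>x. A (X x) = X (A x)" shows "A ((X ^^ n) x) = (X ^^ n) (A x)"
  by (induction n) (auto simp: assms)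

lemma opser_commute:
  assumes "bounded_by r X" "summable (\<lambda>n. \<bar>a n\<bar> * r ^ n)"
    and "bounded_linear A" "\<And>x. A (X x) = X (A x)"
  shows "A (opser a X x) = opser a X (A x)"
  unfolding opser_def
  by (subst bounded_linear.suminf[OF assms(3) opser_summable(2)[OF assms(1,2)]])
     (simp add: linear_cmul[OF bounded_linear.linear[OF assms(3)]] funpow_commute_at[of A X, OF assms(4)])

lemma funpow_adjoint:
  fixes X :: "'a \<Rightarrow> 'a::real_inner"
  assumes "\<And>x y. inner (X x) y = inner x (Y y)"
  shows "inner ((X ^^ n) x) y = inner x ((Y ^^ n) y)"
  by (induction n arbitrary: x y) (simp_all add: assms funpow_swap1)

lemma opser_inner_sums:
  assumes "bounded_by r X" "summable (\<lambda>n. \<bar>a n\<bar> * r ^ n)"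
  shows "(\<lambda>n. a n * inner ((X ^^ n) x) y) sums inner (opser a X x) y"
  using bounded_linear.sums[OF bounded_linear_inner_left opser_sums[OF assms]] by simp

lemma opser_adjoint:
  assumes "bounded_by r X" "bounded_by r Y" "summable (\<lambda>n. \<bar>a n\<bar> * r ^ n)"
    and "\<And>x y. inner (X x) y = inner x (Y y)"
  shows "inner (opser a X x) y = inner x (opser a Y y)"
proof -
  have "(\<lambda>n. a n * inner x ((Y ^^ n) y)) sums inner x (opser a Y y)"
    using opser_inner_sums[OF assms(2,3), of y x] by (simp add: inner_commute)
  thus ?thesis
    using sums_unique2[OF opser_inner_sums[OF assms(1,3), of x y]]
    by (simp add: funpow_adjoint[of X Y, OF assms(4)])
qed

lemma opser_in_subspace:
  assumes "bounded_by r X" "summable (\<lambda>n. \<bar>a n\<bar> * r ^ n)"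
    and "closed S" "subspace S" "\<And>x. x \<in> S \<Longrightarrow> X x \<in> S" "x \<in> S"
  shows "opser a X x \<in> S"
proof (rule closed_sequentially[OF assms(3)])
  have "(X ^^ n) x \<in> S" for n by (induction n) (auto simp: assms)
  thus "(\<Sum>i<n. a i *\<^sub>R (X ^^ i) x) \<in> S" for n
    by (intro subspace_sum subspace_scale assms)
  show "(\<lambda>n. \<Sum>i<n. a i *\<^sub>R (X ^^ i) x) \<longlonglongrightarrow> opser a X x"
    using opser_sums[OF assms(1,2)] by (simp add: sums_def)
qed

lemma opser_finite:
  assumes "\<And>n. n \<notin> A \<Longrightarrow> a n = 0" "finite A"
  shows "opser a X x = (\<Sum>n\<in>A. a n *\<^sub>R (X ^^ n) x)"
  unfolding opser_def by (rule suminf_finite) (use assms in auto)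

text \<open>Partial sums of the composite run over a square of index pairs, those of the product
  series over the triangle i + j < N. Their difference is dominated by the same difference for the
  scalar majorants \<alpha> and \<beta>, which tends to 0 by the scalar Cauchy product
  theorem.\<close>

lemma opser_compose:
  assumes X: "bounded_by r X" and a: "summable (\<lambda>n. \<bar>a n\<bar> * r ^ n)" and b: "summable (\<lambda>n. \<bar>b n\<bar> * r ^ n)"
  shows "opser a X (opser b X x) = opser (\<lambda>k. \<Sum>i\<le>k. a i * b (k - i)) X x"
proof -
  have lin: "linear X" by (rule bounded_by_linear[OF X])
  have r: "0 \<le> r" using X by (simp add: bounded_by_def)
  define A where "A N y = (\<Sum>i<N. a i *\<^sub>R (X ^^ i) y)" for N y
  define B where "B N y = (\<Sum>i<N. b i *\<^sub>R (X ^^ i) y)" for N y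
  define c where "c k = (\<Sum>i\<le>k. a i * b (k - i))" for k
  define \<alpha> where "\<alpha> n = \<bar>a n\<bar> * r ^ n" for n
  define \<beta> where "\<beta> n = \<bar>b n\<bar> * r ^ n" for n
  define \<gamma> where "\<gamma> k = (\<Sum>i\<le>k. \<alpha> i * \<beta> (k - i))" for k
  define g where "g = (\<lambda>(i, j). (a i * b j) *\<^sub>R (X ^^ (i + j)) x)"
  define h where "h = (\<lambda>(i, j). \<alpha> i * \<beta> j)"
  define Sq where "Sq N = {..<N} \<times> {..<N}" for N :: nat
  define Tr where "Tr N = {(i, j). i + j < N}" for N :: nat
  have fin: "finite (Sq N)" "finite (Tr N)" and sub: "Tr N \<subseteq> Sq N" for N
    unfolding Sq_def Tr_def by (auto intro: finite_subset[of _ "{..<N} \<times> {..<N}"])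
  have tri: "(\<Sum>p\<in>Tr N. f p) = (\<Sum>k<N. \<Sum>i\<le>k. f (i, k - i))" for N and f :: "nat \<times> nat \<Rightarrow> 'z::comm_monoid_add"
    using sum.triangle_reindex[of "\<lambda>i j. f (i, j)" N] unfolding Tr_def by (simp add: case_prod_unfold)
  have sq: "(\<Sum>p\<in>Sq N. f p) = (\<Sum>i<N. \<Sum>j<N. f (i, j))" for N and f :: "nat \<times> nat \<Rightarrow> 'z::comm_monoid_add"
    unfolding Sq_def by (simp add: sum.cartesian_product)
  have AB: "A N (B N x) = (\<Sum>p\<in>Sq N. g p)" for N
    unfolding A_def B_def sq g_def
    by (simp add: linear_sum[OF linear_funpow[OF lin]] linear_cmul[OF linear_funpow[OF lin]]
        scaleR_sum_right funpow_add)
  have C: "(\<Sum>k<N. c k *\<^sub>R (X ^^ k) x) = (\<Sum>p\<in>Tr N. g p)" for N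
    unfolding tri g_def c_def by (simp add: scaleR_sum_left)
  have g_le: "norm (g p) \<le> h p * norm x" for p
  proof (cases p)
    case (Pair i j)
    have "norm (g p) \<le> \<bar>a i * b j\<bar> * (r ^ (i + j) * norm x)"
      unfolding g_def Pair using norm_funpow_le[OF X, of "i + j" x]
      by (simp add: mult_left_mono)
    thus ?thesis by (simp add: h_def \<alpha>_def \<beta>_def Pair abs_mult power_add mult_ac)
  qed
  have diff: "norm (A N (B N x) - (\<Sum>k<N. c k *\<^sub>R (X ^^ k) x))
      \<le> ((\<Sum>i<N. \<alpha> i) * (\<Sum>j<N. \<beta> j) - (\<Sum>k<N. \<gamma> k)) * norm x" for N
  proof -
    have "A N (B N x) - (\<Sum>k<N. c k *\<^sub>R (X ^^ k) x) = (\<Sum>p\<in>Sq N - Tr N. g p)"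
      unfolding AB C by (rule sum_diff[OF fin(1) sub, symmetric])
    hence "norm (A N (B N x) - (\<Sum>k<N. c k *\<^sub>R (X ^^ k) x)) \<le> (\<Sum>p\<in>Sq N - Tr N. h p * norm x)"
      using sum_norm_le[of "Sq N - Tr N" g "\<lambda>p. h p * norm x"] g_le by simp
    also have "\<dots> = ((\<Sum>p\<in>Sq N. h p) - (\<Sum>p\<in>Tr N. h p)) * norm x"
      unfolding sum_distrib_right[symmetric] by (subst sum_diff[OF fin(1) sub]) simp
    also have "(\<Sum>p\<in>Sq N. h p) = (\<Sum>i<N. \<alpha> i) * (\<Sum>j<N. \<beta> j)"
      unfolding sq h_def by (simp add: sum_product)
    also have "(\<Sum>p\<in>Tr N. h p) = (\<Sum>k<N. \<gamma> k)" unfolding tri h_def \<gamma>_def by simp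
    finally show ?thesis .
  qed
  have nonneg: "\<alpha> n \<ge> 0" "\<beta> n \<ge> 0" for n using r by (auto simp: \<alpha>_def \<beta>_def)
  have sa: "summable \<alpha>" "summable \<beta>" using a b unfolding \<alpha>_def \<beta>_def by auto
  have "\<gamma> sums ((\<Sum>i. \<alpha> i) * (\<Sum>j. \<beta> j))" unfolding \<gamma>_def
    by (rule Cauchy_product_sums) (use sa nonneg in auto)
  hence \<gamma>: "summable \<gamma>" "(\<lambda>N. \<Sum>k<N. \<gamma> k) \<longlonglongrightarrow> (\<Sum>i. \<alpha> i) * (\<Sum>j. \<beta> j)"
    by (auto simp: summable_def sums_def)
  have "(\<lambda>N. ((\<Sum>i<N. \<alpha> i) * (\<Sum>j<N. \<beta> j) - (\<Sum>k<N. \<gamma> k)) * norm x)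
      \<longlonglongrightarrow> ((\<Sum>i. \<alpha> i) * (\<Sum>j. \<beta> j) - (\<Sum>i. \<alpha> i) * (\<Sum>j. \<beta> j)) * norm x"
    by (intro tendsto_intros summable_LIMSEQ sa \<gamma>)
  hence lim0: "(\<lambda>N. A N (B N x) - (\<Sum>k<N. c k *\<^sub>R (X ^^ k) x)) \<longlonglongrightarrow> 0"
    by (intro Lim_null_comparison[OF always_eventually[OF allI[OF diff]]]) simp
  have c_le: "\<bar>c k\<bar> * r ^ k \<le> \<gamma> k" for k
  proof -
    have "\<bar>c k\<bar> * r ^ k \<le> (\<Sum>i\<le>k. \<bar>a i * b (k - i)\<bar>) * r ^ k"
      unfolding c_def using r by (intro mult_right_mono sum_abs) auto
    also have "\<dots> = \<gamma> k" unfolding \<gamma>_def sum_distrib_right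
    proof (rule sum.cong[OF refl])
      fix i assume "i \<in> {..k}"
      hence "r ^ k = r ^ i * r ^ (k - i)" by (simp flip: power_add)
      thus "\<bar>a i * b (k - i)\<bar> * r ^ k = \<alpha> i * \<beta> (k - i)" by (simp add: \<alpha>_def \<beta>_def abs_mult)
    qed
    finally show ?thesis .
  qed
  have sc: "summable (\<lambda>k. \<bar>c k\<bar> * r ^ k)"
    by (rule summable_comparison_test'[OF \<gamma>(1)]) (use c_le r in auto)
  have "(\<lambda>N. A N (B N x)) \<longlonglongrightarrow> 0 + opser c X x"
    using tendsto_add[OF lim0 opser_sums[OF X sc, of x, unfolded sums_def]] by simp
  \<comment> \<open>The partial sums \<open>A N\<close> are bounded uniformly in N, so the inner and
    the outer limit can be taken together.\<close>
  moreover have "(\<lambda>N. A N (B N x)) \<longlonglongrightarrow> opser a X (opser b X x)"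
  proof -
    let ?z = "opser b X x"
    have A_le: "norm (A N y) \<le> (\<Sum>i. \<alpha> i) * norm y" for N y
    proof -
      have "norm (A N y) \<le> (\<Sum>i<N. \<alpha> i * norm y)" unfolding A_def \<alpha>_def
        by (rule sum_norm_le) (rule opser_norm_bound[OF X])
      also have "\<dots> \<le> (\<Sum>i. \<alpha> i) * norm y" unfolding sum_distrib_right[symmetric]
        by (intro mult_right_mono sum_le_suminf sa) (use nonneg in auto)
      finally show ?thesis .
    qed
    have A_diff: "A N (y - z) = A N y - A N z" for N y z
      unfolding A_def by (simp add: linear_diff[OF linear_funpow[OF lin]] scaleR_diff_right sum_subtractf)
    have "(\<lambda>N. B N x - ?z) \<longlonglongrightarrow> ?z - ?z" unfolding B_def
      by (intro tendsto_diff tendsto_const opser_sums[OF X b, unfolded sums_def])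
    hence "(\<lambda>N. (\<Sum>i. \<alpha> i) * norm (B N x - ?z)) \<longlonglongrightarrow> (\<Sum>i. \<alpha> i) * norm (?z - ?z)"
      by (rule tendsto_mult_left[OF tendsto_norm])
    hence "(\<lambda>N. A N (B N x - ?z)) \<longlonglongrightarrow> 0"
      by (intro Lim_null_comparison[OF always_eventually[OF allI[OF A_le]]]) simp
    from tendsto_add[OF this opser_sums[OF X a, of ?z, unfolded sums_def, folded A_def]]
    show ?thesis by (simp add: A_diff)
  qed
  ultimately show ?thesis unfolding c_def using LIMSEQ_unique by fastforce
qed

section \<open>Real powers of 1 + X by the binomial series\<close>

definition opow :: "real \<Rightarrow> ('a \<Rightarrow> 'a) \<Rightarrow> 'a \<Rightarrow> 'a::{real_inner, banach}" where
  "opow s = opser (\<lambda>n. s gchoose n)"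

text \<open>Vandermonde's identity for the coefficients. Summability is asked for the two exponents,
  instead of r < 1, so that the boundary case r = 1 with exponent 1/2 is covered.\<close>

lemma opow_add:
  assumes "bounded_by r X" "summable (\<lambda>n. \<bar>s gchoose n\<bar> * r ^ n)" "summable (\<lambda>n. \<bar>t gchoose n\<bar> * r ^ n)"
  shows "opow s X (opow t X x) = opow (s + t) X x"
  unfolding opow_def opser_compose[OF assms] gbinomial_Vandermonde[symmetric]
  by (simp add: atMost_atLeast0)

lemma opow_0: "opow 0 X x = x"
proof -
  have "((0::real) gchoose n) = 0" if "n \<notin> {0}" for n
    using that by (cases n) auto
  thus ?thesis unfolding opow_def by (subst opser_finite[of "{0}"]) auto
qed

lemma opow_1: "opow 1 X x = x + X x"
proof -
  have "((1::real) gchoose n) = 0" if "n \<notin> {0, 1}" for n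
    using that binomial_gbinomial[of 1 n, where ?'a = real] by (auto simp: binomial_eq_0)
  thus ?thesis unfolding opow_def by (subst opser_finite[of "{0, 1}"]) auto
qed

text \<open>Factor by factor, the absolute value of - s + i is at most M + i. One majorant thus
  serves all exponents in a bounded set, as the Weierstrass test in
  \<open>continuous_on_opow\<close> requires.\<close>

lemma abs_gchoose_le: "\<bar>s\<bar> \<le> M \<Longrightarrow> \<bar>s gchoose n\<bar> \<le> \<bar>- M gchoose n\<bar>" for s M :: real
proof -
  assume s: "\<bar>s\<bar> \<le> M"
  have "\<bar>pochhammer (- s) n\<bar> \<le> pochhammer M n"
  proof -
    have "\<bar>\<Prod>i = 0..<n. - s + real i\<bar> = (\<Prod>i = 0..<n. \<bar>- s + real i\<bar>)" by (rule abs_prod)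
    also have "\<dots> \<le> (\<Prod>i = 0..<n. M + real i)" using s by (intro prod_mono) auto
    finally show ?thesis by (simp add: pochhammer_prod)
  qed
  thus ?thesis
    by (simp add: gbinomial_pochhammer abs_mult power_abs divide_right_mono)
qed

lemma gchoose_summable:
  assumes "0 \<le> r" "r < (1::real)"
  shows "summable (\<lambda>n. \<bar>s gchoose n\<bar> * r ^ n)"
proof -
  \<comment> \<open>The exponent s itself could be natural, where the series terminates; - M is
    strictly negative, so its series has radius exactly 1, and it still dominates the series for
    s.\<close>
  define M where "M = \<bar>s\<bar> + 1"
  have "- M \<notin> \<nat>" using Nats_induct[of "- M" "\<lambda>x. x \<ge> 0"] by (auto simp: M_def)
  hence "conv_radius (\<lambda>n. - M gchoose n) = 1" by (simp add: conv_radius_gchoose)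
  hence "summable (\<lambda>n. norm ((- M gchoose n) * r ^ n))"
    using assms by (intro abs_summable_in_conv_radius) (auto simp: one_ereal_def)
  hence "summable (\<lambda>n. \<bar>- M gchoose n\<bar> * r ^ n)" using assms by (simp add: abs_mult)
  thus ?thesis
  proof (rule summable_comparison_test')
    fix n :: nat assume "n \<ge> 0"
    show "norm (\<bar>s gchoose n\<bar> * r ^ n) \<le> \<bar>- M gchoose n\<bar> * r ^ n"
      using assms abs_gchoose_le[of s M n] by (auto simp: M_def abs_mult intro!: mult_right_mono)
  qed
qed

lemma continuous_on_opow:
  fixes X :: "'a \<Rightarrow> 'a::{real_inner, banach}"
  assumes X: "bounded_by r X" and r: "r < 1"
  shows "continuous_on UNIV (\<lambda>s. opow s X x)"
proof -
  have r0: "0 \<le> r" using X by (simp add: bounded_by_def)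
  have "continuous_on (cball 0 M) (\<lambda>s. opow s X x)" for M
  proof -
    have "uniform_limit (cball 0 M) (\<lambda>N s. \<Sum>n<N. (s gchoose n) *\<^sub>R (X ^^ n) x)
        (\<lambda>s. \<Sum>n. (s gchoose n) *\<^sub>R (X ^^ n) x) sequentially"
    proof (rule Weierstrass_m_test)
      fix n and s :: real assume "s \<in> cball 0 M"
      hence "\<bar>s\<bar> \<le> M" by simp
      have "norm ((s gchoose n) *\<^sub>R (X ^^ n) x) \<le> (\<bar>s gchoose n\<bar> * r ^ n) * norm x"
        by (rule opser_norm_bound[OF X])
      also have "\<dots> \<le> (\<bar>- M gchoose n\<bar> * r ^ n) * norm x"
        using abs_gchoose_le[OF \<open>\<bar>s\<bar> \<le> M\<close>, of n] r0 by (intro mult_right_mono) auto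
      finally show "norm ((s gchoose n) *\<^sub>R (X ^^ n) x) \<le> (\<bar>- M gchoose n\<bar> * r ^ n) * norm x" .
    qed (intro summable_mult2 gchoose_summable r0 r)
    moreover have "continuous_on (cball 0 M) (\<lambda>s. (s gchoose n) *\<^sub>R (X ^^ n) x)" for n
      unfolding gbinomial_prod_rev by (intro continuous_intros) auto
    ultimately show ?thesis unfolding opow_def opser_def
      by (intro uniform_limit_theorem) (auto intro!: always_eventually continuous_on_sum)
  qed
  hence "continuous_on (ball 0 M) (\<lambda>s. opow s X x)" for M
    using continuous_on_subset[OF _ ball_subset_cball] by blast
  hence "isCont (\<lambda>s. opow s X x) s" for s
    by (rule continuous_on_interior[of "ball 0 (\<bar>s\<bar> + 1)"]) auto
  thus ?thesis by (simp add: continuous_at_imp_continuous_on)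
qed

text \<open>\<open>b\<close> lists the coefficients of sqrt (1 - u). All but the first are
  nonpositive, while the partial sums are the coefficients of (1 - u)^(-1/2) and hence nonnegative.
  This gives absolute convergence on the boundary of the disc, which the radius of convergence does
  not decide.\<close>

lemma half_gchoose:
  defines "b \<equiv> \<lambda>n. (- 1) ^ n * ((1/2::real) gchoose n)"
  shows "n > 0 \<Longrightarrow> b n \<le> 0" "(\<Sum>k<n. b k) \<ge> 0" "summable (\<lambda>n. \<bar>(1/2::real) gchoose n\<bar>)"
proof -
  have b: "b n = pochhammer (- 1/2) n / fact n" for n
    by (simp add: b_def gbinomial_pochhammer)
  show neg: "b n \<le> 0" if n: "n > 0" for n
  proof -
    obtain m where m: "n = Suc m" using n by (cases n) auto
    have "pochhammer (- 1/2 :: real) n = (- 1/2) * pochhammer (1/2) m"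
      unfolding m pochhammer_rec by simp
    moreover have "pochhammer (1/2 :: real) m \<ge> 0" by (rule pochhammer_nonneg) simp
    ultimately show ?thesis unfolding b by (simp add: divide_le_0_iff)
  qed
  have part: "(\<Sum>k<n. b k) \<ge> 0" for n
  proof (cases n)
    case (Suc m)
    have "(\<Sum>k<n. b k) = (\<Sum>k\<le>m. (1/2 gchoose k) * (- 1) ^ k)"
      unfolding Suc lessThan_Suc_atMost b_def by (simp add: mult.commute)
    also have "\<dots> = (- 1) ^ m * (- 1/2 gchoose m)"
      by (subst gbinomial_sum_lower_neg) simp
    also have "\<dots> = pochhammer (1/2) m / fact m"
      by (simp add: gbinomial_pochhammer)
    also have "\<dots> \<ge> 0" by (intro divide_nonneg_nonneg pochhammer_nonneg) auto
    finally show ?thesis .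
  qed simp
  show "(\<Sum>k<n. b k) \<ge> 0" by (rule part)
  show "summable (\<lambda>n. \<bar>(1/2::real) gchoose n\<bar>)"
  proof (rule summableI_nonneg_bounded)
    fix n
    \<comment> \<open>The only positive coefficient is b 0 = 1, for which 1 = 2 - 1; every other
      absolute value is - b k.\<close>
    have "\<bar>(1/2::real) gchoose k\<bar> = (if k = 0 then 2 else 0) - b k" for k
    proof (cases "k = 0")
      case False
      have "\<bar>(1/2::real) gchoose k\<bar> = \<bar>b k\<bar>" by (simp add: b_def abs_mult)
      thus ?thesis using neg[of k] False by simp
    qed (simp add: b_def)
    hence "(\<Sum>k<n. \<bar>(1/2::real) gchoose k\<bar>) = (\<Sum>k<n. if k = 0 then 2 else 0) - (\<Sum>k<n. b k)"
      by (simp add: sum_subtractf)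
    also have "\<dots> \<le> (\<Sum>k<n. if k = 0 then 2 else 0)" using part[of n] by simp
    also have "\<dots> \<le> 2" by (simp add: sum.delta)
    finally show "(\<Sum>k<n. \<bar>(1/2::real) gchoose k\<bar>) \<le> 2" .
  qed simp
qed

text \<open>\<open>A\<close> is sqrt (1 + X) with 1 + X = B o B. Since X is only known to be a
  contraction, the series is summed at r = 1. The commutation clause is what later makes the
  solution space of A x = B x invariant under the representation.\<close>

lemma operator_abs:
  fixes B :: "'a \<Rightarrow> 'a::{real_inner, banach}"
  assumes lin: "linear B" and sym: "\<And>x y. inner (B x) y = inner x (B y)"
    and contr: "\<And>x. norm (B x) \<le> norm x"
  obtains A where "bounded_linear A" "\<And>x. A (A x) = B (B x)" "\<And>x. 0 \<le> inner (A x) x"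
    "\<And>C x. bounded_linear C \<Longrightarrow> (\<And>y. C (B y) = B (C y)) \<Longrightarrow> C (A x) = A (C x)"
proof -
  define X where "X x = B (B x) - x" for x
  have linX: "linear X" unfolding X_def
    by (intro linear_compose_sub linear_compose[OF lin lin, unfolded o_def] linear_ident)
  \<comment> \<open>The triangle inequality would only give the factor 2. In the expanded square the
    cross term - 2 |B x|^2 absorbs |B (B x)|^2.\<close>
  have nX: "norm (X x) \<le> norm x" for x
  proof -
    have "(norm (X x))\<^sup>2 = (norm (B (B x)))\<^sup>2 - 2 * (norm (B x))\<^sup>2 + (norm x)\<^sup>2"
      unfolding X_def by (simp add: power2_norm_eq_inner inner_diff_left inner_diff_right
          sym[of "B x" x] inner_commute[of x "B (B x)"])
    moreover have "(norm (B (B x)))\<^sup>2 \<le> (norm (B x))\<^sup>2" using contr[of "B x"] by (simp add: power_mono)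
    ultimately have "(norm (X x))\<^sup>2 \<le> (norm x)\<^sup>2" using zero_le_power2[of "norm (B x)"] by linarith
    thus ?thesis by (rule power2_le_imp_le) simp
  qed
  have X: "bounded_by 1 X" using linX nX by (simp add: bounded_by_def)
  have sm: "summable (\<lambda>n. \<bar>(1/2::real) gchoose n\<bar> * 1 ^ n)" using half_gchoose(3) by simp
  define A where "A = opow (1/2) X"
  have "A (A x) = B (B x)" for x
    unfolding A_def opow_add[OF X sm sm] by (simp add: opow_1 X_def)
  moreover have "bounded_linear A" unfolding A_def opow_def
    by (rule bounded_by_bounded_linear[OF opser_bounded_by[OF X sm]])
  moreover have "C (A x) = A (C x)" if C: "bounded_linear C" "\<And>y. C (B y) = B (C y)" for C x
    unfolding A_def opow_def
    by (rule opser_commute[OF X sm C(1)]) (simp add: X_def linear_diff[OF bounded_linear.linear[OF C(1)]] C(2))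
  moreover have "0 \<le> inner (A x) x" for x
  proof -
    have "(\<lambda>N. \<Sum>n<N. (1/2 gchoose n) * inner ((X ^^ n) x) x) \<longlonglongrightarrow> inner (A x) x"
      using opser_inner_sums[OF X sm, of x x] unfolding sums_def A_def opow_def .
    moreover have "0 \<le> (\<Sum>n<N. (1/2 gchoose n) * inner ((X ^^ n) x) x)" for N
    proof -
      let ?b = "\<lambda>n. (- 1) ^ n * ((1/2::real) gchoose n)"
      \<comment> \<open>For n > 0 the signed coefficient is nonpositive and (-1)^n (X^n x, x) is at
        most |x|^2, so each term is at least its scalar counterpart, whose partial sums are
        nonnegative.\<close>
      have "?b n * (norm x)\<^sup>2 \<le> (1/2 gchoose n) * inner ((X ^^ n) x) x" for n
      proof (cases "n = 0")
        case False
        let ?i = "(- 1) ^ n * inner ((X ^^ n) x) x"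
        have "\<bar>?i\<bar> \<le> norm ((X ^^ n) x) * norm x"
          by (simp add: abs_mult Cauchy_Schwarz_ineq2)
        also have "\<dots> \<le> norm x * norm x"
          using norm_funpow_le[OF X, of n x] by (intro mult_right_mono) auto
        finally have "?i \<le> (norm x)\<^sup>2" by (simp add: power2_eq_square)
        hence "?b n * (norm x)\<^sup>2 \<le> ?b n * ?i"
          using half_gchoose(1)[of n] False by (intro mult_left_mono_neg) auto
        also have "\<dots> = ((- 1) ^ n * (- 1) ^ n) * ((1/2 gchoose n) * inner ((X ^^ n) x) x)"
          by (simp only: mult_ac)
        also have "(- 1) ^ n * (- 1) ^ n = (1::real)" by (simp flip: power_mult_distrib)
        finally show ?thesis by simp
      qed (simp add: power2_norm_eq_inner)
      hence "(\<Sum>n<N. ?b n * (norm x)\<^sup>2) \<le> (\<Sum>n<N. (1/2 gchoose n) * inner ((X ^^ n) x) x)"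
        by (rule sum_mono)
      moreover have "0 \<le> (\<Sum>n<N. ?b n * (norm x)\<^sup>2)"
        unfolding sum_distrib_right[symmetric] by (intro mult_nonneg_nonneg half_gchoose(2)) simp
      ultimately show ?thesis by linarith
    qed
    ultimately show ?thesis by (intro LIMSEQ_le_const) auto
  qed
  ultimately show thesis using that by blast
qed

text \<open>Polarisation with the test vector y that has the direction of R x and the length of x;
  the parallelogram law then bounds (R x, y).\<close>

lemma norm_le_of_quadratic_form_le:
  fixes R :: "'a \<Rightarrow> 'a::real_inner"
  assumes lin: "linear R" and sym: "\<And>x y. inner (R x) y = inner x (R y)"
    and S: "subspace S" "\<And>x. x \<in> S \<Longrightarrow> R x \<in> S"
    and le: "\<And>x. x \<in> S \<Longrightarrow> \<bar>inner (R x) x\<bar> \<le> \<beta> * (norm x)\<^sup>2"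
    and x: "x \<in> S"
  shows "norm (R x) \<le> \<beta> * norm x"
proof (cases "R x = 0 \<or> x = 0")
  case True
  have "0 \<le> (\<beta> * norm x) * norm x"
    using order_trans[OF abs_ge_zero le[OF x]] by (simp add: power2_eq_square mult.assoc)
  hence "\<beta> * norm x \<ge> 0" by (cases "x = 0") (auto simp: zero_le_mult_iff)
  thus ?thesis using True linear_0[OF lin] by auto
next
  case False
  define y where "y = (norm x / norm (R x)) *\<^sub>R R x"
  have y: "y \<in> S" "norm y = norm x" using False x S by (auto simp: y_def intro: subspace_scale)
  have "4 * inner (R x) y = inner (R (x + y)) (x + y) - inner (R (x - y)) (x - y)"
    by (simp add: linear_add[OF lin] linear_diff[OF lin] inner_add_left inner_add_right inner_diff_left
        inner_diff_right sym[of y x] inner_commute[of y "R x"])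
  also have "\<dots> \<le> \<beta> * (norm (x + y))\<^sup>2 + \<beta> * (norm (x - y))\<^sup>2"
    using le[OF subspace_add[OF S(1) x y(1)]] le[OF subspace_diff[OF S(1) x y(1)]] by linarith
  also have "\<dots> = \<beta> * (2 * (norm x)\<^sup>2 + 2 * (norm y)\<^sup>2)"
    by (simp add: power2_norm_eq_inner inner_add_left inner_add_right inner_diff_left inner_diff_right algebra_simps)
  finally have "inner (R x) y \<le> \<beta> * (norm x)\<^sup>2" using y by simp
  moreover have "inner (R x) y = norm x * norm (R x)"
    using False by (simp add: y_def flip: power2_norm_eq_inner) (simp add: power2_eq_square)
  ultimately show ?thesis using False by (simp add: power2_eq_square mult.commute mult.left_commute)
qed

lemma floor_dyadic_LIMSEQ: "(\<lambda>k. real_of_int \<lfloor>2 ^ k * s\<rfloor> / 2 ^ k) \<longlonglongrightarrow> s"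
proof (rule tendsto_sandwich[OF always_eventually always_eventually])
  show "\<forall>k. s - (1/2) ^ k \<le> real_of_int \<lfloor>2 ^ k * s\<rfloor> / 2 ^ k"
  proof
    fix k :: nat
    have "2 ^ k * s - 1 \<le> real_of_int \<lfloor>2 ^ k * s\<rfloor>" by linarith
    hence "(2 ^ k * s - 1) / 2 ^ k \<le> real_of_int \<lfloor>2 ^ k * s\<rfloor> / 2 ^ k" by (intro divide_right_mono) auto
    thus "s - (1/2) ^ k \<le> real_of_int \<lfloor>2 ^ k * s\<rfloor> / 2 ^ k" by (simp add: diff_divide_distrib power_one_over)
  qed
  show "\<forall>k. real_of_int \<lfloor>2 ^ k * s\<rfloor> / 2 ^ k \<le> s" by (auto simp: divide_le_eq mult.commute)
  have "(\<lambda>k. s - (1/2) ^ k) \<longlonglongrightarrow> s - 0" by (intro tendsto_intros LIMSEQ_power_zero) auto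
  thus "(\<lambda>k. s - (1/2) ^ k) \<longlonglongrightarrow> s" by simp
qed auto

text \<open>1 + Y is both the adjoint and the inverse of 1 + X, so the claim is (1 + Y)^s (1 + X)^s
  = 1. Positivity of this product takes the place of multiplying binomial series in two different
  operators.\<close>

lemma opow_isometry:
  fixes X Y :: "'a \<Rightarrow> 'a::{real_inner, banach}"
  assumes X: "bounded_by r X" and Y: "bounded_by r Y" and r: "r < 1"
    and adj: "\<And>x y. inner (X x) y = inner x (Y y)"
    and inv: "\<And>x. x + X x + Y (x + X x) = x"
    and comm: "\<And>x. X (Y x) = Y (X x)"
  shows "inner (opow s X x) (opow s X y) = inner x y"
proof -
  have sm: "summable (\<lambda>n. \<bar>s gchoose n\<bar> * r ^ n)" for s
    using X r by (intro gchoose_summable) (auto simp: bounded_by_def)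
  note add = opow_add[OF X sm sm] and addY = opow_add[OF Y sm sm]
  have lin: "linear (opow s X)" for s unfolding opow_def by (rule opser_linear[OF X sm])
  have bl: "bounded_linear (opow s X)" for s unfolding opow_def
    by (rule bounded_by_bounded_linear[OF opser_bounded_by[OF X sm]])
  have linY: "linear (opow s Y)" for s unfolding opow_def by (rule opser_linear[OF Y sm])
  have adjs: "inner (opow s X x) y = inner x (opow s Y y)" for s x y
    unfolding opow_def by (rule opser_adjoint[OF X Y sm adj])
  have XoY: "opow t Y (X x) = X (opow t Y x)" for t x
    unfolding opow_def by (rule opser_commute[OF Y sm bounded_by_bounded_linear[OF X] comm, symmetric])
  have commute: "opow s X (opow t Y x) = opow t Y (opow s X x)" for s t x
    unfolding opow_def[of s] 
    by (rule opser_commute[where A = "opow t Y", OF X sm _ XoY, symmetric])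
       (simp add: opow_def bounded_by_bounded_linear[OF opser_bounded_by[OF Y sm]])
  (* E s is positive with E s o E s = E (2 * s) and E 1 = id, so E s = id for dyadic s, and then
     for all s by continuity *)
  define E where "E s x = opow s Y (opow s X x)" for s x
  have EE: "E s (E s x) = E (2 * s) x" for s x
    unfolding E_def commute[of s s] add addY by simp
  have E1: "E 1 x = x" for x
    unfolding E_def opow_1 by (rule inv)
  have linE: "linear (E s)" for s unfolding E_def using linear_compose[OF lin linY] by (simp add: o_def)
  have E_dyadic: "E (1 / 2 ^ k) x = x" for k x
  proof (induction k arbitrary: x)
    case (Suc k)
    let ?s = "1 / 2 ^ Suc k :: real"
    \<comment> \<open>\<open>E ?s\<close> is an involution and y lies in its -1 part; positivity of
      \<open>E ?s\<close> then leaves only y = 0.\<close>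
    define y where "y = E ?s x - x"
    have "E ?s (E ?s x) = x" unfolding EE using Suc by simp
    hence "E ?s y = - y" by (simp add: y_def linear_diff[OF linE])
    hence "- (norm y)\<^sup>2 = inner y (E ?s y)" by (simp add: power2_norm_eq_inner)
    also have "\<dots> = (norm (opow ?s X y))\<^sup>2" by (simp add: E_def adjs[symmetric] power2_norm_eq_inner)
    finally have "(norm y)\<^sup>2 \<le> 0" using zero_le_power2[of "norm (opow ?s X y)"] by linarith
    thus ?case by (simp add: y_def)
  qed (simp add: E1)
  have norm_dyadic: "norm (opow (1 / 2 ^ k) X x) = norm x" for k x
    using adjs[of "1 / 2 ^ k" x "opow (1 / 2 ^ k) X x"] E_dyadic[of k x]
    by (simp add: E_def norm_eq_sqrt_inner)
  have norm_nat: "norm (opow (real m / 2 ^ k) X x) = norm x" for m k x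
  proof (induction m)
    case (Suc m)
    have "opow (real (Suc m) / 2 ^ k) X x = opow (1 / 2 ^ k) X (opow (real m / 2 ^ k) X x)"
      unfolding add by (simp add: add_divide_distrib)
    thus ?case using Suc norm_dyadic by simp
  qed (simp add: opow_0)
  have norm_int: "norm (opow (real_of_int m / 2 ^ k) X x) = norm x" for m k x
  proof (cases "m \<ge> 0")
    case True
    thus ?thesis using norm_nat[of "nat m" k x] by simp
  next
    case False
    have "norm x = norm (opow (real (nat (- m)) / 2 ^ k) X (opow (real_of_int m / 2 ^ k) X x))"
      unfolding add using False by (simp add: opow_0)
    thus ?thesis unfolding norm_nat ..
  qed
  have norm_eq: "norm (opow s X x) = norm x" for s x
  proof -
    have "isCont (\<lambda>s. opow s X x) s"
      using continuous_on_opow[OF X r, of x] by (simp add: continuous_on_eq_continuous_at)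
    from isCont_tendsto_compose[OF this floor_dyadic_LIMSEQ[of s]]
    have "(\<lambda>k. norm (opow (real_of_int \<lfloor>2 ^ k * s\<rfloor> / 2 ^ k) X x)) \<longlonglongrightarrow> norm (opow s X x)"
      by (rule tendsto_norm)
    thus ?thesis unfolding norm_int using LIMSEQ_unique tendsto_const by blast
  qed
  show ?thesis
    using norm_eq[of s "x + y"] norm_eq[of s x] norm_eq[of s y]
    by (simp add: linear_add[OF lin] dot_norm)
qed

text \<open>The series is formed in X = (U - 1) P, with P the projection onto N, so that the gap on
  N becomes a norm bound on the whole space. The resulting C s acts as a power of U on N and as the
  identity on the orthogonal complement. In the last clause both A and its adjoint preserve N, which
  makes A commute with P.\<close>

lemma unitary_one_parameter_group:
  fixes U U' :: "'a \<Rightarrow> 'a::{real_inner, banach}"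
  assumes U: "linear U" "linear U'" "\<And>x y. inner (U x) y = inner x (U' y)"
      "\<And>x. U' (U x) = x" "\<And>x. U (U' x) = x"
    and N: "closed N" "subspace N" "\<And>x. x \<in> N \<Longrightarrow> U x \<in> N" "\<And>x. x \<in> N \<Longrightarrow> U' x \<in> N"
    and r: "0 \<le> r" "r < 1" "\<And>x. x \<in> N \<Longrightarrow> norm (U x - x) \<le> r * norm x"
  obtains C :: "real \<Rightarrow> 'a \<Rightarrow> 'a" where
    "\<And>s. linear (C s)" "\<And>s x y. inner (C s x) (C s y) = inner x y"
    "\<And>x. C 0 x = x" "\<And>s t x. C s (C t x) = C (s + t) x"
    "\<And>x. x \<in> N \<Longrightarrow> C 1 x = U x" "\<And>s x. x \<in> N \<Longrightarrow> C s x \<in> N"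
    "\<And>x. continuous_on UNIV (\<lambda>s. C s x)"
    "\<And>A A' s x. bounded_linear A \<Longrightarrow> \<forall>x y. inner (A x) y = inner x (A' y) \<Longrightarrow>
      \<forall>x\<in>N. A x \<in> N \<and> A' x \<in> N \<Longrightarrow> \<forall>x. A (U x) = U (A x) \<Longrightarrow> A (C s x) = C s (A x)"
proof -
  obtain P where P: "linear P" "\<And>x. P x \<in> N" "\<And>x y. y \<in> N \<Longrightarrow> inner (x - P x) y = 0"
    "\<And>x. x \<in> N \<Longrightarrow> P x = x" "\<And>x y. inner (P x) y = inner x (P y)" "\<And>x. norm (P x) \<le> norm x"
    "\<And>x p. p \<in> N \<Longrightarrow> (\<And>y. y \<in> N \<Longrightarrow> inner (x - p) y = 0) \<Longrightarrow> P x = p"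
    using orthogonal_projection[OF N(2,1)] by blast
  have adj': "inner (U' x) y = inner x (U y)" for x y using U(3)[of y x] by (simp add: inner_commute)
  have PU: "P (U x) = U (P x)" for x
    by (rule projection_commute[OF U(1) N(3,4) U(3) P(2,3,7)])
  have PU': "P (U' x) = U' (P x)" for x
    by (rule projection_commute[OF U(2) N(4,3) adj' P(2,3,7)])
  have PP: "P (P x) = P x" for x by (rule P(4)[OF P(2)])
  define X where "X x = U (P x) - P x" for x
  define Y where "Y x = U' (P x) - P x" for x
  have linX: "linear X" and linY: "linear Y" unfolding X_def Y_def
    by (intro linear_compose_sub linear_compose[OF P(1) U(1), unfolded o_def]
        linear_compose[OF P(1) U(2), unfolded o_def] P(1))+
  have normU': "norm (U' x) = norm x" for x
    using adj'[of x "U' x"] by (simp add: U(5) norm_eq_sqrt_inner)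
  have rP: "r * norm (P x) \<le> r * norm x" for x using r P(6) by (intro mult_left_mono) auto
  have X: "bounded_by r X" unfolding bounded_by_def
    using linX r(1) order_trans[OF r(3)[OF P(2)] rP] by (auto simp: X_def)
  have "norm (Y x) \<le> r * norm x" for x
  proof -
    have "Y x = - U' (U (P x) - P x)" by (simp add: Y_def linear_diff[OF U(2)] U(4))
    hence "norm (Y x) = norm (X x)" by (simp add: normU' X_def)
    thus ?thesis using X by (simp add: bounded_by_def)
  qed
  hence Y: "bounded_by r Y" unfolding bounded_by_def using linY r(1) by auto
  have adj: "inner (X x) y = inner x (Y y)" for x y
    by (simp add: X_def Y_def inner_diff_left inner_diff_right U(3) P(5) PU')
  have PX: "P (X x) = X x" and PY: "P (Y x) = Y x" for x
    by (simp_all add: X_def Y_def linear_diff[OF P(1)] PU PU' PP)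
  have inv: "x + X x + Y (x + X x) = x" for x
    by (simp add: Y_def[of "x + X x"] linear_add[OF P(1)] PX) (simp add: X_def U(4) linear_diff[OF U(2)])
  have comm: "X (Y x) = Y (X x)" for x
    by (simp add: X_def[of "Y x"] Y_def[of "X x"] PX PY)
       (simp add: X_def Y_def U(4,5) linear_diff[OF U(1)] linear_diff[OF U(2)])
  have sm: "summable (\<lambda>n. \<bar>s gchoose n\<bar> * r ^ n)" for s
    using r by (intro gchoose_summable) auto
  show thesis
  proof (rule that[of "\<lambda>s. opow s X"])
    show "linear (opow s X)" for s unfolding opow_def by (rule opser_linear[OF X sm])
    show "inner (opow s X x) (opow s X y) = inner x y" for s x y
      by (rule opow_isometry[OF X Y r(2) adj inv comm])
    show "opow 0 X x = x" for x by (rule opow_0)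
    show "opow s X (opow t X x) = opow (s + t) X x" for s t x by (rule opow_add[OF X sm sm])
    show "opow 1 X x = U x" if "x \<in> N" for x by (simp add: opow_1 X_def P(4)[OF that])
    show "opow s X x \<in> N" if "x \<in> N" for s x unfolding opow_def
      by (rule opser_in_subspace[OF X sm N(1,2) _ that]) (auto simp: X_def intro!: subspace_diff N P)
    show "continuous_on UNIV (\<lambda>s. opow s X x)" for x by (rule continuous_on_opow[OF X r(2)])
    show "A (opow s X x) = opow s X (A x)" if "bounded_linear A" "\<forall>x y. inner (A x) y = inner x (A' y)"
      "\<forall>x\<in>N. A x \<in> N \<and> A' x \<in> N" "\<forall>x. A (U x) = U (A x)" for A A' s x
    proof -
      have A: "bounded_linear A" "\<And>x y. inner (A x) y = inner x (A' y)"
        "\<And>x. x \<in> N \<Longrightarrow> A x \<in> N" "\<And>x. x \<in> N \<Longrightarrow> A' x \<in> N" "\<And>x. A (U x) = U (A x)"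
        using that by auto
      have linA: "linear A" by (rule bounded_linear.linear[OF A(1)])
      have PA: "P (A x) = A (P x)" for x
        by (rule projection_commute[OF linA A(3,4,2) P(2,3,7)])
      show ?thesis unfolding opow_def
        by (rule opser_commute[OF X sm A(1)]) (simp add: X_def linear_diff[OF linA] A(5) PA)
    qed
  qed
qed

section \<open>Fourier coefficients\<close>

lemma integral_periodic_shift:
  fixes h :: "real \<Rightarrow> 'a::banach"
  assumes cont: "continuous_on UNIV h" and per: "\<And>t. h (t + 2 * pi) = h t"
  shows "integral {-pi..pi} (\<lambda>t. h (t + c)) = integral {-pi..pi} h"
proof -
  have per_nat: "h (t + 2 * pi * real n) = h t" for t n
  proof (induction n)
    case (Suc n)
    have "t + 2 * pi * real (Suc n) = (t + 2 * pi * real n) + 2 * pi" by (simp add: algebra_simps)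
    thus ?case using Suc per by metis
  qed simp
  have per_int: "h (t + 2 * pi * real_of_int k) = h t" for t k
  proof (cases "k \<ge> 0")
    case True
    thus ?thesis using per_nat[of t "nat k"] by simp
  next
    case False
    thus ?thesis using per_nat[of "t + 2 * pi * real_of_int k" "nat (- k)"] by simp
  qed
  \<comment> \<open>The shift is reduced modulo 2 pi, so that the overhang of the shifted interval
    can be moved back by a single period.\<close>
  define k where "k = \<lfloor>c / (2 * pi)\<rfloor>"
  define d where "d = c - 2 * pi * real_of_int k"
  have "real_of_int k \<le> c / (2 * pi)" "c / (2 * pi) < real_of_int k + 1" unfolding k_def by linarith+
  hence d: "0 \<le> d" "d \<le> 2 * pi" by (auto simp: d_def field_simps)
  have hd: "h (t + c) = h (d + t)" for t
    using per_int[of "d + t" k] by (simp add: d_def algebra_simps)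
  have int: "h integrable_on {a..b}" for a b
    by (intro integrable_continuous_interval continuous_on_subset[OF cont]) auto
  have "integral {-pi..pi} (\<lambda>t. h (t + c)) = integral {-pi..pi} (h \<circ> ((+) d))"
    by (simp add: hd o_def)
  also have "\<dots> = integral {-pi + d..pi + d} h" by (rule integral_shift_Icc_real)
  also have "\<dots> = integral {-pi + d..pi} h + integral {pi..pi + d} h"
    using d by (intro Henstock_Kurzweil_Integration.integral_combine[symmetric] int) auto
  also have "integral {pi..pi + d} h = integral {-pi..-pi + d} h"
  proof -
    have "integral {-pi..-pi + d} (h \<circ> ((+) (2 * pi))) = integral {-pi + 2 * pi..-pi + d + 2 * pi} h"
      by (rule integral_shift_Icc_real)
    moreover have "h \<circ> ((+) (2 * pi)) = h" using per by (auto simp: add.commute)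
    moreover have "-pi + 2 * pi = pi" "-pi + d + 2 * pi = pi + d" by auto
    ultimately show ?thesis by simp
  qed
  also have "integral {-pi + d..pi} h + integral {-pi..-pi + d} h = integral {-pi..pi} h"
    using d by (subst add.commute, intro Henstock_Kurzweil_Integration.integral_combine int) auto
  finally show ?thesis .
qed

text \<open>To be applied to f t = Re (W t x, x), which is dominated by f 0 by Cauchy-Schwarz. If
  all coefficients vanished, f would be orthogonal to every power of a cosine polynomial peaked at
  0, where f is positive.\<close>

lemma exists_nonzero_cos_coefficient:
  fixes f :: "real \<Rightarrow> real"
  assumes cont: "continuous_on UNIV f" and f0: "f 0 > 0" and le: "\<And>t. \<bar>f t\<bar> \<le> f 0"
  obtains n :: int where "integral {-pi..pi} (\<lambda>t. cos (of_int n * t) * f t) \<noteq> 0"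
proof (rule ccontr)
  assume "\<not> thesis"
  hence zero: "integral {-pi..pi} (\<lambda>t. cos (of_int n * t) * f t) = 0" for n :: int
    using that by blast
  have "isCont f 0" using cont by (simp add: continuous_on_eq_continuous_at)
  then obtain d0 where d0: "d0 > 0" "\<And>t. \<bar>t\<bar> < d0 \<Longrightarrow> \<bar>f t - f 0\<bar> < f 0 / 2"
    using f0 unfolding continuous_at_eps_delta dist_real_def
    by (metis diff_zero half_gt_zero)
  define d where "d = min (d0 / 2) 1"
  have fd: "f t \<ge> f 0 / 2" if "\<bar>t\<bar> \<le> d" for t
  proof -
    have "\<bar>f t - f 0\<bar> < f 0 / 2" using d0(1) that by (intro d0(2)) (auto simp: d_def)
    thus ?thesis by linarith
  qed
  have d: "0 < d" "d \<le> 1" using d0 by (auto simp: d_def)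
  (* Q > 1 near 0, while abs Q <= 1 where abs t >= d, so the powers of Q concentrate at 0 *)
  define Q where "Q t = 1 + cos t - cos d" for t
  define q where "q = 1 + cos (d / 2) - cos d"
  have dpi: "d < pi / 2" using d pi_gt3 by linarith
  have q: "q > 1" unfolding q_def using cos_monotone_0_pi[of "d/2" d] d dpi by auto
  have contQ: "continuous_on A Q" for A unfolding Q_def by (intro continuous_intros)
  have contf: "continuous_on A f" for A using continuous_on_subset[OF cont] by auto
  have int: "(\<lambda>t. Q t ^ N * (cos (c * t) * f t)) integrable_on {a..b}" for N c a b
    by (intro integrable_continuous_interval continuous_intros contQ contf)
  \<comment> \<open>The frequency n must vary in the induction: cos t * cos (n t) brings in n + 1
    and n - 1.\<close>
  have orth: "integral {-pi..pi} (\<lambda>t. Q t ^ N * (cos (of_int n * t) * f t)) = 0" for N and n :: int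
  proof (induction N arbitrary: n)
    case 0
    show ?case using zero by simp
  next
    case (Suc N)
    let ?g = "\<lambda>n t. Q t ^ N * (cos (of_int n * t) * f t)"
    have "Q t ^ Suc N * (cos (of_int n * t) * f t)
        = (1 - cos d) * ?g n t + ((1/2) * ?g (n + 1) t + (1/2) * ?g (n - 1) t)" for t
    proof -
      have "cos t * cos (of_int n * t) = (cos (of_int (n + 1) * t) + cos (of_int (n - 1) * t)) / 2"
        by (simp add: ring_distribs cos_add cos_diff)
      hence "(1 - cos d + cos t) * cos (of_int n * t)
        = (1 - cos d) * cos (of_int n * t) + (cos (of_int (n + 1) * t) + cos (of_int (n - 1) * t)) / 2"
        by (simp add: algebra_simps)
      hence "Q t ^ N * f t * ((1 - cos d + cos t) * cos (of_int n * t)) = Q t ^ N * f t *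
         ((1 - cos d) * cos (of_int n * t) + (cos (of_int (n + 1) * t) + cos (of_int (n - 1) * t)) / 2)"
        by simp
      moreover have "Q t = 1 - cos d + cos t" by (simp add: Q_def)
      ultimately show ?thesis by (simp only: power_Suc) (simp add: algebra_simps add_divide_distrib)
    qed
    hence "integral {-pi..pi} (\<lambda>t. Q t ^ Suc N * (cos (of_int n * t) * f t))
      = integral {-pi..pi} (\<lambda>t. (1 - cos d) * ?g n t + ((1/2) * ?g (n + 1) t + (1/2) * ?g (n - 1) t))"
      by presburger
    also have "\<dots> = (1 - cos d) * integral {-pi..pi} (?g n)
        + ((1/2) * integral {-pi..pi} (?g (n + 1)) + (1/2) * integral {-pi..pi} (?g (n - 1)))"
      by (simp only: integral_add integral_mult_right integrable_add integrable_on_mult_right int)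
    also have "\<dots> = 0" by (simp only: Suc)
    finally show ?case .
  qed
  \<comment> \<open>Adding \<open>f 0\<close> makes the integrand nonnegative on the whole period at
    a cost independent of N. The integral can then be cut down to the interval of radius d / 2,
    where it grows at least like q^N.\<close>
  have lower: "Q t ^ N * f t + f 0 \<ge> 0" if t: "\<bar>t\<bar> \<le> pi" for t N
  proof (cases "\<bar>t\<bar> \<le> d")
    case True
    have "cos d \<le> cos \<bar>t\<bar>" using True d dpi by (intro cos_monotone_0_pi_le) auto
    hence "Q t \<ge> 0" by (simp add: Q_def)
    thus ?thesis using fd[OF True] f0 by simp
  next
    case False
    have "cos \<bar>t\<bar> \<le> cos d" using False d t by (intro cos_monotone_0_pi_le) auto
    moreover have "cos d \<ge> 0" using d dpi by (intro cos_ge_zero) auto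
    ultimately have "\<bar>Q t\<bar> \<le> 1" using cos_ge_minus_one[of t] cos_le_one[of d]
      unfolding Q_def cos_abs_real by linarith
    hence "\<bar>Q t ^ N\<bar> \<le> 1" by (simp add: power_abs power_le_one)
    hence "\<bar>Q t ^ N * f t\<bar> \<le> 1 * f 0" unfolding abs_mult by (intro mult_mono le) auto
    thus ?thesis by linarith
  qed
  have inner_lower: "Q t ^ N * f t + f 0 \<ge> q ^ N * (f 0 / 2)" if t: "\<bar>t\<bar> \<le> d / 2" for t N
  proof -
    have "cos (d / 2) \<le> cos \<bar>t\<bar>" using t d dpi by (intro cos_monotone_0_pi_le) auto
    hence "q \<le> Q t" by (simp add: Q_def q_def)
    hence "q ^ N \<le> Q t ^ N" "0 \<le> Q t ^ N" using q by (auto intro!: power_mono)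
    hence "q ^ N * (f 0 / 2) \<le> Q t ^ N * f t" using fd[of t] t d f0 q by (intro mult_mono) auto
    thus ?thesis using f0 by simp
  qed
  have int': "(\<lambda>t. Q t ^ N * f t + f 0) integrable_on {a..b}" for N a b
    by (intro integrable_continuous_interval continuous_intros contQ contf)
  have "d * (q ^ N * (f 0 / 2)) \<le> 2 * pi * f 0" for N
  proof -
    have "d * (q ^ N * (f 0 / 2)) = integral {-d/2..d/2} (\<lambda>t. q ^ N * (f 0 / 2))"
      using d by simp
    also have "\<dots> \<le> integral {-d/2..d/2} (\<lambda>t. Q t ^ N * f t + f 0)"
      by (intro integral_le int' inner_lower) auto
    also have "\<dots> \<le> integral {-pi..pi} (\<lambda>t. Q t ^ N * f t + f 0)"
      using d dpi by (intro integral_subset_le int') (auto intro!: lower)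
    also have "\<dots> = integral {-pi..pi} (\<lambda>t. Q t ^ N * f t) + integral {-pi..pi} (\<lambda>t. f 0)"
      using int[of N 0 "-pi" pi] by (intro integral_add) auto
    also have "\<dots> = 2 * pi * f 0" using orth[of N 0] by simp
    finally show ?thesis .
  qed
  moreover obtain N where "4 * pi / d < q ^ N" using real_arch_pow[OF q] by blast
  hence "2 * pi * f 0 < d * (q ^ N * (f 0 / 2))" using d f0 by (simp add: field_simps)
  ultimately show False by (meson not_le)
qed

section \<open>Existence of tau-symmetric vectors\<close>

text \<open>Strong continuity of isometries gives joint continuity: A s (u s) is A s (u s - u t), of
  norm |u s - u t|, plus a point on the orbit of the fixed vector u t.\<close>

lemma continuous_on_isometry_orbit:
  fixes A :: "real \<Rightarrow> 'a \<Rightarrow> 'a::real_normed_vector"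
  assumes lin: "\<And>t. linear (A t)" and iso: "\<And>t x. norm (A t x) = norm x"
    and cont: "\<And>x. continuous_on UNIV (\<lambda>t. A t x)" and u: "continuous_on UNIV u"
  shows "continuous_on UNIV (\<lambda>t. A t (u t))"
  unfolding continuous_on_def
proof
  fix t :: real
  have "((\<lambda>s. A s (u s - u t)) \<longlongrightarrow> 0) (at t within UNIV)"
  proof (rule Lim_null_comparison)
    have "((\<lambda>s. norm (u s - u t)) \<longlongrightarrow> norm (u t - u t)) (at t within UNIV)"
      using u by (intro tendsto_intros) (auto simp: continuous_on_def)
    thus "((\<lambda>s. norm (u s - u t)) \<longlongrightarrow> 0) (at t within UNIV)" by simp
  qed (simp add: iso)
  moreover have "((\<lambda>s. A s (u t)) \<longlongrightarrow> A t (u t)) (at t within UNIV)"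
    using cont[of "u t"] by (auto simp: continuous_on_def)
  ultimately have "((\<lambda>s. A s (u s - u t) + A s (u t)) \<longlongrightarrow> 0 + A t (u t)) (at t within UNIV)"
    by (rule tendsto_add)
  thus "((\<lambda>s. A s (u s)) \<longlongrightarrow> A t (u t)) (at t within UNIV)"
    by (simp add: linear_diff[OF lin])
qed

lemma bounded_linear_isometry:
  assumes "linear A" "\<And>x. norm (A x) = norm x" shows "bounded_linear A"
  by (rule bounded_linear_intro[where K = 1])
     (auto simp: assms linear_add[OF assms(1)] linear_cmul[OF assms(1)])

lemma linear_eq_on_dense:
  assumes "bounded_linear A" "bounded_linear B" "closure (span (range e)) = UNIV"
    and "\<And>p. A (e p) = B (e p)"
  shows "A x = B x"
proof -
  have span: "\<And>y. y \<in> span (range e) \<Longrightarrow> A y = B y"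
    using linear_eq_on_span[OF bounded_linear.linear[OF assms(1)] bounded_linear.linear[OF assms(2)]] assms(4)
    by blast
  have "closed {y. A y = B y}"
    using assms(1,2) by (intro closed_Collect_eq linear_continuous_on)
  hence "closure (span (range e)) \<subseteq> {y. A y = B y}"
    using span by (intro closure_minimal) auto
  thus ?thesis using assms(3) by auto
qed

section \<open>The circle group and the scalars in a fixed representation\<close>

locale sl2t_rep =
  fixes I :: "'h::{real_inner, banach} \<Rightarrow> 'h" and V :: "sl2t \<Rightarrow> 'h \<Rightarrow> 'h"
  assumes cs: "complex_structure I" and rep: "cont_unitary_rep_SL2t I V"
begin

lemma I_lin: "linear I" and I_I [simp]: "I (I x) = - x" and I_inner [simp]: "inner (I x) (I y) = inner x y"
  using cs by (auto simp: complex_structure_def)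

lemma I_skew: "inner (I x) y = - inner x (I y)"
  using I_inner[of x "I y"] by (simp add: inner_commute)

lemma I_norm [simp]: "norm (I x) = norm x"
  by (simp add: norm_eq_sqrt_inner)

lemma I_neg [simp]: "I (- x) = - I x"
  by (rule linear_neg[OF I_lin])

lemma V_lin: "g \<in> SL2t \<Longrightarrow> linear (V g)"
  and V_inner: "g \<in> SL2t \<Longrightarrow> inner (V g x) (V g y) = inner x y"
  and V_I: "g \<in> SL2t \<Longrightarrow> V g (I x) = I (V g x)"
  and V_surj: "g \<in> SL2t \<Longrightarrow> surj (V g)"
  using rep by (auto simp: cont_unitary_rep_SL2t_def unitary_op_def)

lemma V_mult: "g \<in> SL2t \<Longrightarrow> h \<in> SL2t \<Longrightarrow> V (sl2t_mult g h) x = V g (V h x)"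
  and V_one [simp]: "V sl2t_one x = x"
  and V_cont: "continuous_on SL2t (\<lambda>g. V g x)"
  using rep by (auto simp: cont_unitary_rep_SL2t_def)

lemma V_bl: "g \<in> SL2t \<Longrightarrow> bounded_linear (V g)"
  by (rule bounded_linear_isometry) (auto simp: V_lin V_inner norm_eq_sqrt_inner)

lemma I_bl: "bounded_linear I"
  by (rule bounded_linear_isometry) (auto simp: I_lin)

definition K :: "real \<Rightarrow> 'h \<Rightarrow> 'h" where
  "K t = V (rotK t)"

text \<open>Multiplication by the complex scalar exp (i t).\<close>

definition R :: "real \<Rightarrow> 'h \<Rightarrow> 'h" where
  "R t x = cos t *\<^sub>R x + sin t *\<^sub>R I x"

lemma K_lin: "linear (K t)" and K_inner: "inner (K t x) (K t y) = inner x y"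
  and K_I: "K t (I x) = I (K t x)"
  by (simp_all add: K_def V_lin V_inner V_I)

lemma K_norm [simp]: "norm (K t x) = norm x"
  by (simp add: norm_eq_sqrt_inner K_inner)

lemma K_K: "K s (K t x) = K (s + t) x"
  by (simp add: K_def V_mult[symmetric] rotK_mult_rotK)

lemma K_0 [simp]: "K 0 x = x"
  by (simp add: K_def rotK_0)

lemma K_adj: "inner (K t x) y = inner x (K (- t) y)"
  using K_inner[of "- t" "K t x" y] by (simp add: K_K)

lemma K_cont: "continuous_on UNIV (\<lambda>t. K t x)"
  unfolding K_def by (rule continuous_on_compose2[OF V_cont continuous_on_rotK]) auto

lemma K_central: "g \<in> SL2t \<Longrightarrow> V g (K (2 * pi) x) = K (2 * pi) (V g x)"
  by (simp add: K_def V_mult[symmetric] rotK_central)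

lemma K_central': "g \<in> SL2t \<Longrightarrow> V g (K (- (2 * pi)) x) = K (- (2 * pi)) (V g x)"
  using arg_cong[OF K_central[of g "K (- (2 * pi)) x"], of "K (- (2 * pi))"] by (simp add: K_K)

lemma R_lin: "linear (R t)"
  unfolding R_def
  by (intro linear_compose_add linear_compose_scale_right linear_ident I_lin)

lemma R_R: "R s (R t x) = R (s + t) x"
  by (simp add: R_def linear_add[OF I_lin] linear_cmul[OF I_lin] cos_add sin_add algebra_simps)

lemma R_0 [simp]: "R 0 x = x"
  by (simp add: R_def)

lemma R_adj: "inner (R t x) y = inner x (R (- t) y)"
  by (simp add: R_def inner_add_left inner_diff_right I_skew)

lemma R_inner: "inner (R t x) (R t y) = inner x y"
  by (simp add: R_adj R_R)

lemma R_norm [simp]: "norm (R t x) = norm x"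
  by (simp add: norm_eq_sqrt_inner R_inner)

lemma R_bl: "bounded_linear (R t)"
  by (rule bounded_linear_isometry) (auto simp: R_lin)

lemma R_commute:
  assumes "linear A" "\<And>x. A (I x) = I (A x)" shows "A (R t x) = R t (A x)"
  by (simp add: R_def linear_add[OF assms(1)] linear_cmul[OF assms(1)] assms(2))

lemma R_I: "R t (I x) = I (R t x)"
  by (simp add: R_commute[of I, OF I_lin])

lemma V_R: "g \<in> SL2t \<Longrightarrow> V g (R t x) = R t (V g x)"
  by (rule R_commute[OF V_lin V_I])

lemma K_R: "K s (R t x) = R t (K s x)"
  by (rule R_commute[OF K_lin K_I])

lemma V_diagA_adj:
  assumes "r > 0" shows "inner (V (diagA r) x) y = inner x (V (diagA (1 / r)) y)"
proof -
  have "V (diagA (1 / r)) (V (diagA r) x) = x"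
    using assms by (simp add: V_mult[symmetric] diagA_inverse)
  thus ?thesis using V_inner[of "diagA (1 / r)" "V (diagA r) x" y] assms by simp
qed

lemma V_KAK:
  assumes "r > 0"
  shows "V (sl2t_mult (rotK s) (sl2t_mult (diagA r) (rotK t))) x = K s (V (diagA r) (K t x))"
  using assms by (simp add: K_def V_mult)

text \<open>h is the inverse of g, read off from its Cartan factors. In this form the adjunction
  carries over to \<open>tauG g\<close>, because \<open>tauG\<close> only negates the
  angles.\<close>

lemma V_adjoint:
  assumes "g \<in> SL2t"
  obtains h where "h \<in> SL2t" "\<And>x y. inner (V g x) y = inner x (V h y)"
    "\<And>x y. inner (V (tauG g) x) y = inner x (V (tauG h) y)"
proof -
  obtain s r t where r: "r > 0" and g: "g = sl2t_mult (rotK s) (sl2t_mult (diagA r) (rotK t))"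
    using SL2t_KAK[OF assms] by blast
  let ?h = "sl2t_mult (rotK (- t)) (sl2t_mult (diagA (1 / r)) (rotK (- s)))"
  have r': "1 / r > 0" using r by simp
  show thesis
  proof (rule that[of ?h])
    show "?h \<in> SL2t" using r' by simp
    show "inner (V g x) y = inner x (V ?h y)" for x y
      unfolding g V_KAK[OF r] V_KAK[OF r'] by (simp add: K_adj V_diagA_adj[OF r])
    show "inner (V (tauG g) x) y = inner x (V (tauG ?h) y)" for x y
      using r r' unfolding g by (simp add: tauG_mult V_KAK[OF r] V_KAK[OF r'] K_adj V_diagA_adj[OF r])
  qed
qed

section \<open>Invariant subspaces and the central unitary\<close>

definition inv_subspace :: "'h set \<Rightarrow> bool" where
  "inv_subspace S \<longleftrightarrow> closed S \<and> subspace S \<and> (\<forall>x\<in>S. I x \<in> S) \<and> (\<forall>g\<in>SL2t. \<forall>x\<in>S. V g x \<in> S)"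

lemma inv_subspaceD:
  assumes "inv_subspace S"
  shows "closed S" "subspace S" "x \<in> S \<Longrightarrow> I x \<in> S" "g \<in> SL2t \<Longrightarrow> x \<in> S \<Longrightarrow> V g x \<in> S"
    "x \<in> S \<Longrightarrow> K t x \<in> S" "x \<in> S \<Longrightarrow> R t x \<in> S"
  using assms by (auto simp: inv_subspace_def K_def R_def intro!: subspace_add subspace_scale)

text \<open>\<open>H \<alpha>\<close> is the real part of exp (i \<alpha>) times the central
  unitary, and \<open>N \<alpha>\<close>, where B agrees with its absolute value A, is the part of S
  on which H is at least 3/5. There the squared distance to the identity is at most 2 - 6/5 = 4/5,
  which is below (9/10)^2. The threshold c = 3/5 has to satisfy 2 - 2 c < 1 for the gap and 2 c^2 <
  1 for some \<open>N \<alpha>\<close> to be nonzero.\<close>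

lemma exists_spectral_subspace:
  assumes S: "inv_subspace S" and ne: "y \<in> S" "y \<noteq> 0"
  obtains \<alpha> N x where "inv_subspace N" "N \<subseteq> S" "x \<in> N" "x \<noteq> 0"
    "\<And>x. x \<in> N \<Longrightarrow> norm (R \<alpha> (K (2 * pi) x) - x) \<le> 9/10 * norm x"
proof -
  note SD = inv_subspaceD[OF S]
  let ?T = "K (2 * pi)" and ?T' = "K (- (2 * pi))"
  define H where "H \<alpha> x = (1/2) *\<^sub>R (R \<alpha> (?T x) + R (- \<alpha>) (?T' x))" for \<alpha> x
  \<comment> \<open>Halving makes B a contraction, as \<open>operator_abs\<close> requires: H - 3/5
    has norm at most 8/5.\<close>
  define B where "B \<alpha> x = (1/2) *\<^sub>R (H \<alpha> x - (3/5) *\<^sub>R x)" for \<alpha> x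
  have linH: "linear (H \<alpha>)" for \<alpha> unfolding H_def
    by (intro linear_compose_add linear_compose_scale_right
        linear_compose[OF K_lin R_lin, unfolded o_def])
  have linB: "linear (B \<alpha>)" for \<alpha> unfolding B_def
    by (intro linear_compose_sub linear_compose_scale_right linH linear_ident)
  have symH: "inner (H \<alpha> x) y = inner x (H \<alpha> y)" for \<alpha> x y
    by (simp add: H_def inner_add_left inner_add_right R_adj K_adj K_R)
  have symB: "inner (B \<alpha> x) y = inner x (B \<alpha> y)" for \<alpha> x y
    by (simp add: B_def inner_diff_left inner_diff_right symH)
  have normH: "norm (H \<alpha> x) \<le> norm x" for \<alpha> x
    using norm_triangle_ineq[of "R \<alpha> (?T x)" "R (- \<alpha>) (?T' x)"] by (simp add: H_def)
  have normB: "norm (B \<alpha> x) \<le> norm x" for \<alpha> x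
  proof -
    have "norm (H \<alpha> x - (3/5) *\<^sub>R x) \<le> norm x + 3/5 * norm x"
      using norm_triangle_ineq4[of "H \<alpha> x" "(3/5) *\<^sub>R x"] normH[of \<alpha> x] by simp
    also have "\<dots> \<le> 2 * norm x" using norm_ge_zero[of x] by linarith
    finally show ?thesis by (simp add: B_def)
  qed
  have VH: "V g (H \<alpha> x) = H \<alpha> (V g x)" if "g \<in> SL2t" for g \<alpha> x
    using that by (simp add: H_def linear_add[OF V_lin] linear_cmul[OF V_lin] V_R K_central K_central')
  have VB: "V g (B \<alpha> x) = B \<alpha> (V g x)" if "g \<in> SL2t" for g \<alpha> x
    using that by (simp add: B_def linear_diff[OF V_lin] linear_cmul[OF V_lin] VH)
  have IB: "I (B \<alpha> x) = B \<alpha> (I x)" for \<alpha> x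
    by (simp add: B_def H_def linear_diff[OF I_lin] linear_cmul[OF I_lin] linear_add[OF I_lin] R_I K_I)
  define Q where "Q \<alpha> A \<longleftrightarrow> bounded_linear A \<and> (\<forall>x. A (A x) = B \<alpha> (B \<alpha> x)) \<and> (\<forall>x. 0 \<le> inner (A x) x) \<and>
    (\<forall>C x. bounded_linear C \<longrightarrow> (\<forall>y. C (B \<alpha> y) = B \<alpha> (C y)) \<longrightarrow> C (A x) = A (C x))" for \<alpha> A
  have "\<exists>A. Q \<alpha> A" for \<alpha>
    by (rule operator_abs[OF linB symB normB, of \<alpha>]) (auto simp: Q_def)
  hence "\<forall>\<alpha>. \<exists>A. Q \<alpha> A" ..
  from choice[OF this] obtain A where "\<And>\<alpha>. Q \<alpha> (A \<alpha>)" by blast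
  hence A: "\<And>\<alpha>. bounded_linear (A \<alpha>)" "\<And>\<alpha> x. A \<alpha> (A \<alpha> x) = B \<alpha> (B \<alpha> x)"
    "\<And>\<alpha> x. 0 \<le> inner (A \<alpha> x) x"
    "\<And>\<alpha> C x. bounded_linear C \<Longrightarrow> (\<And>y. C (B \<alpha> y) = B \<alpha> (C y)) \<Longrightarrow> C (A \<alpha> x) = A \<alpha> (C x)"
    by (simp_all add: Q_def)
  note linA = bounded_linear.linear[OF A(1)]
  have blB: "bounded_linear (B \<alpha>)" for \<alpha>
    by (rule bounded_linear_intro[where K = 1]) (auto simp: linear_add[OF linB] linear_cmul[OF linB] normB)
  define N where "N \<alpha> = {x \<in> S. A \<alpha> x = B \<alpha> x}" for \<alpha>
  have invN: "inv_subspace (N \<alpha>)" for \<alpha>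
    unfolding inv_subspace_def
  proof (intro conjI ballI)
    have "closed {x. A \<alpha> x = B \<alpha> x}"
      using A(1) blB by (intro closed_Collect_eq linear_continuous_on)
    moreover have "N \<alpha> = S \<inter> {x. A \<alpha> x = B \<alpha> x}" by (auto simp: N_def)
    ultimately show "closed (N \<alpha>)" using SD(1) by (simp add: closed_Int)
    show "subspace (N \<alpha>)"
      using SD(2) by (auto simp: subspace_def N_def linear_0[OF linA] linear_0[OF linB]
         linear_add[OF linA] linear_add[OF linB] linear_cmul[OF linA] linear_cmul[OF linB])
    show "I x \<in> N \<alpha>" if "x \<in> N \<alpha>" for x
      using that SD(3) A(4)[OF I_bl IB, of \<alpha> x, symmetric] by (simp add: N_def IB[symmetric])
    show "V g x \<in> N \<alpha>" if "g \<in> SL2t" "x \<in> N \<alpha>" for g x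
      using that SD(4) A(4)[OF V_bl VB, of g \<alpha> x, symmetric] by (simp add: N_def VB[symmetric])
  qed
  have gap: "norm (R \<alpha> (?T x) - x) \<le> 9/10 * norm x" if x: "x \<in> N \<alpha>" for \<alpha> x
  proof -
    have "0 \<le> inner (B \<alpha> x) x" using x A(3)[of \<alpha> x] by (simp add: N_def)
    hence "inner (H \<alpha> x) x \<ge> 3/5 * (norm x)\<^sup>2"
      by (simp add: B_def inner_diff_left power2_norm_eq_inner)
    moreover have "inner (R (- \<alpha>) (?T' x)) x = inner x (R \<alpha> (?T x))"
      by (simp add: R_adj K_adj K_R)
    hence "inner (R (- \<alpha>) (?T' x)) x = inner (R \<alpha> (?T x)) x"
      by (subst (2) inner_commute)
    ultimately have "inner (R \<alpha> (?T x)) x \<ge> 3/5 * (norm x)\<^sup>2"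
      by (simp add: H_def inner_add_left)
    moreover have "(norm (R \<alpha> (?T x) - x))\<^sup>2 = (norm (R \<alpha> (?T x)))\<^sup>2 + (norm x)\<^sup>2 - 2 * inner (R \<alpha> (?T x)) x"
      by (simp only: power2_norm_eq_inner) (simp add: inner_diff_left inner_diff_right inner_commute)
    ultimately have "(norm (R \<alpha> (?T x) - x))\<^sup>2 \<le> 4/5 * (norm x)\<^sup>2" by simp
    also have "\<dots> \<le> (9/10 * norm x)\<^sup>2" by (simp add: power_mult_distrib power2_eq_square)
    finally show ?thesis by (rule power2_le_imp_le) simp
  qed
  (* otherwise the real and imaginary parts of the central unitary both have norm at most 3/5 on S,
     but 2 * (3/5)^2 < 1 *)
  have "\<exists>\<alpha> x. x \<in> N \<alpha> \<and> x \<noteq> 0"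
  proof (rule ccontr)
    assume "\<not> ?thesis"
    hence N0: "x = 0" if "x \<in> N \<alpha>" for x \<alpha> using that by blast
    obtain P where P: "linear P" "\<And>x. P x \<in> S" "\<And>x y. y \<in> S \<Longrightarrow> inner (x - P x) y = 0"
      "\<And>x. x \<in> S \<Longrightarrow> P x = x" "\<And>x y. inner (P x) y = inner x (P y)" "\<And>x. norm (P x) \<le> norm x"
      "\<And>x p. p \<in> S \<Longrightarrow> (\<And>y. y \<in> S \<Longrightarrow> inner (x - p) y = 0) \<Longrightarrow> P x = p"
      using orthogonal_projection[OF SD(2,1)] by blast
    have blP: "bounded_linear P"
      by (rule bounded_linear_intro[where K = 1]) (auto simp: linear_add[OF P(1)] linear_cmul[OF P(1)] P(6))
    have HS: "H \<alpha> x \<in> S" if "x \<in> S" for \<alpha> x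
      unfolding H_def using SD that by (intro subspace_scale subspace_add) auto
    have BS: "B \<alpha> x \<in> S" if "x \<in> S" for \<alpha> x
      unfolding B_def using SD HS that by (intro subspace_scale subspace_diff) auto
    have PB: "P (B \<alpha> x) = B \<alpha> (P x)" for \<alpha> x
      by (rule projection_commute[OF linB BS BS symB P(2,3,7)])
    have AS: "A \<alpha> x \<in> S" if "x \<in> S" for \<alpha> x
      using A(4)[OF blP PB, of \<alpha> x] P(2)[of "A \<alpha> x"] P(4)[OF that] by simp
    have le: "inner (H \<alpha> y) y \<le> 3/5 * (norm y)\<^sup>2" if y: "y \<in> S" for \<alpha> y
    proof -
      \<comment> \<open>Since A A = B B and A commutes with B, A (A + B) = B (A + B), so A + B maps
        S into \<open>N \<alpha>\<close>. If that is zero, B = - A is nonpositive on S.\<close>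
      have "A \<alpha> y + B \<alpha> y \<in> N \<alpha>"
        using AS[OF y] BS[OF y] SD(2) A(4)[OF blB, of \<alpha> \<alpha> y]
        by (simp add: N_def subspace_add linear_add[OF linA] linear_add[OF linB] A(2) add.commute)
      from N0[OF this] have "B \<alpha> y = - A \<alpha> y" by (simp add: eq_neg_iff_add_eq_0 add.commute)
      hence "inner (B \<alpha> y) y \<le> 0" using A(3)[of \<alpha> y] by simp
      thus ?thesis by (simp add: B_def inner_diff_left power2_norm_eq_inner)
    qed
    have abs_le: "\<bar>inner (H \<alpha> y) y\<bar> \<le> 3/5 * (norm y)\<^sup>2" if y: "y \<in> S" for \<alpha> y
    proof -
      \<comment> \<open>Adding pi to \<alpha> changes the sign of H, so upper bounds for all
        \<alpha> are lower bounds too.\<close>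
      have "R (\<alpha> + pi) z = - R \<alpha> z" "R (- (\<alpha> + pi)) z = - R (- \<alpha>) z" for z
        by (simp_all add: R_def cos_diff sin_diff)
      hence "H (\<alpha> + pi) y = - H \<alpha> y"
        by (simp only: H_def minus_add_distrib[symmetric] scaleR_minus_right)
      thus ?thesis using le[OF y, of \<alpha>] le[OF y, of "\<alpha> + pi"] by simp
    qed
    have nH: "norm (H \<alpha> y) \<le> 3/5 * norm y" for \<alpha>
      by (rule norm_le_of_quadratic_form_le[OF linH symH SD(2) HS abs_le ne(1)])
    have nH2: "(norm (H \<alpha> y))\<^sup>2 \<le> 9/25 * (norm y)\<^sup>2" for \<alpha>
      using power_mono[OF nH[of \<alpha>], of 2] by (simp add: power_mult_distrib power2_eq_square)
    have "(norm (H 0 y))\<^sup>2 + (norm (H (pi/2) y))\<^sup>2 = (norm y)\<^sup>2"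
    proof -
      have "H 0 y = (1/2) *\<^sub>R (?T y + ?T' y)" "H (pi/2) y = I ((1/2) *\<^sub>R (?T y - ?T' y))"
        by (simp_all add: H_def) (simp add: R_def linear_cmul[OF I_lin] linear_diff[OF I_lin])
      hence "(norm (H 0 y))\<^sup>2 + (norm (H (pi/2) y))\<^sup>2
          = ((norm (?T y + ?T' y))\<^sup>2 + (norm (?T y - ?T' y))\<^sup>2) / 4"
        by (simp add: power_divide add_divide_distrib)
      also have "\<dots> = (2 * (norm (?T y))\<^sup>2 + 2 * (norm (?T' y))\<^sup>2) / 4"
        by (simp only: power2_norm_eq_inner) (simp add: inner_add_left inner_add_right inner_diff_left inner_diff_right)
      finally show ?thesis by simp
    qed
    hence "(norm y)\<^sup>2 \<le> 18/25 * (norm y)\<^sup>2" using nH2[of 0] nH2[of "pi / 2"] by linarith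
    thus False using ne(2) by simp
  qed
  then obtain \<alpha> x where "x \<in> N \<alpha>" "x \<noteq> 0" by blast
  moreover have "N \<alpha> \<subseteq> S" by (auto simp: N_def)
  ultimately show thesis using that[OF invN _ _ _ gap] by blast
qed

text \<open>On N the group C satisfies C 1 = exp (i \<alpha>) K (2 pi), so with \<beta> = \<alpha> /
  (2 pi) the group W t = K t exp (i \<beta> t) C (- t / (2 pi)) fixes x at t = 2 pi. A Fourier
  coefficient z of that orbit satisfies W t z = exp (i m t) z, and solving for K t z yields D t =
  exp (i (m - \<beta>) t) C (t / (2 pi)).\<close>

lemma exists_torus_quasi_eigenvector:
  assumes S: "inv_subspace S" and ne: "y \<in> S" "y \<noteq> 0"
  obtains D z where "z \<in> S" "z \<noteq> 0" "\<And>t. linear (D t)" "\<And>t x y. inner (D t x) (D t y) = inner x y"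
    "\<And>s t x. D s (D t x) = D (s + t) x" "\<And>x. D 0 x = x"
    "\<And>t g x. g \<in> SL2t \<Longrightarrow> V g (D t x) = D t (V g x)" "\<And>t x. I (D t x) = D t (I x)"
    "\<And>t. K t z = D t z"
proof -
  obtain \<alpha> N x where N: "inv_subspace N" "N \<subseteq> S" and x: "x \<in> N" "x \<noteq> 0"
    and gap: "\<And>x. x \<in> N \<Longrightarrow> norm (R \<alpha> (K (2 * pi) x) - x) \<le> 9/10 * norm x"
    by (rule exists_spectral_subspace[OF S ne]) (rule that)
  note ND = inv_subspaceD[OF N(1)]
  define U where "U x = R \<alpha> (K (2 * pi) x)" for x
  define U' where "U' x = R (- \<alpha>) (K (- (2 * pi)) x)" for x
  have linU: "linear U" "linear U'" unfolding U_def U'_def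
    by (intro linear_compose[OF K_lin R_lin, unfolded o_def])+
  have adjU: "inner (U x) y = inner x (U' y)" for x y by (simp add: U_def U'_def R_adj K_adj K_R)
  have invU: "U' (U x) = x" "U (U' x) = x" for x by (simp_all add: U_def U'_def K_R R_R K_K)
  have UN: "U x \<in> N" "U' x \<in> N" if "x \<in> N" for x using that ND by (auto simp: U_def U'_def)
  have r0: "0 \<le> (9/10::real)" and r1: "(9/10::real) < 1" by simp_all
  have gapU: "norm (U x - x) \<le> 9/10 * norm x" if "x \<in> N" for x using gap[OF that] by (simp add: U_def)
  obtain C :: "real \<Rightarrow> 'h \<Rightarrow> 'h" where linC: "\<And>s. linear (C s)" and innerC: "\<And>s x y. inner (C s x) (C s y) = inner x y"
    and C0: "\<And>x. C 0 x = x" and CC: "\<And>s t x. C s (C t x) = C (s + t) x"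
    and C1: "\<And>x. x \<in> N \<Longrightarrow> C 1 x = U x" and CN: "\<And>s x. x \<in> N \<Longrightarrow> C s x \<in> N"
    and contC: "\<And>x. continuous_on UNIV (\<lambda>s. C s x)"
    and commC: "\<And>A A' s x. bounded_linear A \<Longrightarrow> \<forall>x y. inner (A x) y = inner x (A' y) \<Longrightarrow>
      \<forall>x\<in>N. A x \<in> N \<and> A' x \<in> N \<Longrightarrow> \<forall>x. A (U x) = U (A x) \<Longrightarrow> A (C s x) = C s (A x)"
    by (rule unitary_one_parameter_group[OF linU adjU invU ND(1,2) UN r0 r1 gapU])
       (assumption | rule that)+
  have normC [simp]: "norm (C s x) = norm x" for s x by (simp add: norm_eq_sqrt_inner innerC)
  have IC: "I (C s x) = C s (I x)" for s x
    by (rule commC[where A' = "\<lambda>x. - I x"])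
       (use ND in \<open>auto simp: I_bl I_skew U_def K_I R_I intro: subspace_neg\<close>)
  have VC: "V g (C s x) = C s (V g x)" if g: "g \<in> SL2t" for g s x
  proof -
    obtain h where h: "h \<in> SL2t" "\<And>x y. inner (V g x) y = inner x (V h y)"
      by (rule V_adjoint[OF g]) (rule that)
    show ?thesis
    proof (rule commC[where A = "V g" and A' = "V h"])
      show "\<forall>x\<in>N. V g x \<in> N \<and> V h x \<in> N" using ND g h(1) by blast
      show "\<forall>x. V g (U x) = U (V g x)" using g by (simp add: U_def V_R K_central)
    qed (use V_bl[OF g] h(2) in auto)
  qed
  have CR: "C s (R t x) = R t (C s x)" for s t x by (rule R_commute[OF linC IC[symmetric]])
  have KC: "K t (C s x) = C s (K t x)" for s t x by (simp add: K_def VC)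
  define \<beta> where "\<beta> = \<alpha> / (2 * pi)"
  define D where "D m t x = R (of_int m * t - \<beta> * t) (C (t / (2 * pi)) x)" for m :: int and t x
  define W where "W t x = K t (R (\<beta> * t) (C (- t / (2 * pi)) x))" for t x
  note lin_simps = linear_add[OF linC] linear_add[OF R_lin] linear_add[OF K_lin]
    linear_cmul[OF linC] linear_cmul[OF R_lin] linear_cmul[OF K_lin]
  have linW: "linear (W t)" for t by (rule linearI) (simp_all add: W_def lin_simps)
  have innerW: "inner (W t x) (W t y) = inner x y" for t x y by (simp add: W_def K_inner R_inner innerC)
  have normW: "norm (W t x) = norm x" for t x by (simp add: W_def)
  have WW: "W s (W t x) = W (s + t) x" for s t x
    by (simp add: W_def KC CR K_R K_K R_R CC add_divide_distrib diff_divide_distrib algebra_simps)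
  have W0: "W 0 x = x" for x by (simp add: W_def C0)
  have WI: "W t (I x) = I (W t x)" for t x by (simp add: W_def IC[symmetric] R_I K_I)
  have WR: "W t (R s x) = R s (W t x)" for s t x by (rule R_commute[OF linW WI])
  have WN: "W t x \<in> N" if "x \<in> N" for t x using that ND CN by (auto simp: W_def)
  have W_per: "W (2 * pi) x = x"
  proof -
    have "W (2 * pi) x = U (C (- 1) x)" by (simp add: W_def U_def K_R \<beta>_def)
    also have "\<dots> = C 1 (C (- 1) x)" by (rule C1[OF CN[OF x(1)], symmetric])
    finally show ?thesis by (simp add: CC C0)
  qed
  have contR: "continuous_on UNIV (\<lambda>t. R (c * t) w)" for c w
    unfolding R_def by (intro continuous_intros)
  have contRu: "continuous_on UNIV (\<lambda>t. R (c * t) (u t))" if "continuous_on UNIV u" for c u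
    by (rule continuous_on_isometry_orbit[where A = "\<lambda>t. R (c * t)", OF R_lin R_norm contR that])
  have contC': "continuous_on UNIV (\<lambda>t. C (- t / (2 * pi)) v)" for v
    by (rule continuous_on_compose2[OF contC[of v], of UNIV "\<lambda>t. - t / (2 * pi)"])
       (auto intro!: continuous_intros)
  have contW: "continuous_on UNIV (\<lambda>t. W t v)" for v
    unfolding W_def
    by (rule continuous_on_isometry_orbit[where A = K, OF K_lin K_norm K_cont contRu[OF contC']])
  define h where "h m t = R (- of_int m * t) (W t x)" for m :: int and t
  define z where "z m = integral {-pi..pi} (h m)" for m :: int
  have cont_h: "continuous_on UNIV (h m)" for m
    unfolding h_def by (rule contRu[OF contW])
  have int_h: "h m integrable_on {a..b}" for m a b
    by (intro integrable_continuous_interval continuous_on_subset[OF cont_h]) auto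
  have per_h: "h m (t + 2 * pi) = h m t" for m t
  proof -
    have "R (- of_int m * (t + 2 * pi)) v = R (- of_int m * t) v" for v
    proof -
      have "- of_int m * (t + 2 * pi) = - of_int m * t + (2 * pi) * of_int (- m)"
        by (simp add: algebra_simps)
      hence "cos (- of_int m * (t + 2 * pi)) = cos (- of_int m * t)"
        "sin (- of_int m * (t + 2 * pi)) = sin (- of_int m * t)"
        using sin_int_2pin[of "- m"] cos_int_2pin[of "- m"] by (simp_all only: sin_add cos_add)
      thus ?thesis by (simp only: R_def)
    qed
    moreover have "W (t + 2 * pi) x = W t x" using WW[of t "2 * pi" x] W_per by simp
    ultimately show ?thesis by (simp only: h_def)
  qed
  \<comment> \<open>The projection onto N is bounded, so it passes under the integral, where it
    fixes the integrand.\<close>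
  have zN: "z m \<in> N" for m
  proof -
    obtain P where P: "linear P" "\<And>x. P x \<in> N" "\<And>x. x \<in> N \<Longrightarrow> P x = x" "\<And>x. norm (P x) \<le> norm x"
      using orthogonal_projection[OF ND(2,1)] by metis
    have blP: "bounded_linear P"
      by (rule bounded_linear_intro[where K = 1]) (auto simp: linear_add[OF P(1)] linear_cmul[OF P(1)] P(4))
    have "P (z m) = integral {-pi..pi} (P \<circ> h m)"
      unfolding z_def by (rule integral_linear[OF int_h blP, symmetric])
    also have "P \<circ> h m = h m" using P(3) ND(6) WN[OF x(1)] by (auto simp: h_def)
    finally show ?thesis using P(2) by (metis z_def)
  qed
  have W_z: "W t (z m) = R (of_int m * t) (z m)" for m t
  proof -
    have "W t (z m) = integral {-pi..pi} (W t \<circ> h m)"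
      unfolding z_def by (rule integral_linear[OF int_h bounded_linear_isometry[OF linW normW], symmetric])
    also have "W t \<circ> h m = R (of_int m * t) \<circ> (\<lambda>s. h m (s + t))"
      by (auto simp: h_def WR WW R_R algebra_simps)
    also have "integral {-pi..pi} (R (of_int m * t) \<circ> (\<lambda>s. h m (s + t)))
        = R (of_int m * t) (integral {-pi..pi} (\<lambda>s. h m (s + t)))"
    proof (rule integral_linear[OF _ R_bl])
      have "continuous_on UNIV (\<lambda>s. h m (s + t))"
        by (rule continuous_on_compose2[OF cont_h[of m], of UNIV "\<lambda>s. s + t"]) (auto intro!: continuous_intros)
      thus "(\<lambda>s. h m (s + t)) integrable_on {-pi..pi}"
        by (rule integrable_continuous_interval[OF continuous_on_subset]) simp
    qed
    also have "integral {-pi..pi} (\<lambda>s. h m (s + t)) = z m"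
      unfolding z_def by (rule integral_periodic_shift[OF cont_h per_h])
    finally show ?thesis .
  qed
  have "\<exists>m. z m \<noteq> 0"
  proof -
    define f where "f t = inner (W t x) x" for t
    have "continuous_on UNIV f" unfolding f_def by (intro continuous_intros contW)
    moreover have "f 0 > 0" using x(2) by (simp add: f_def W0)
    moreover have "\<bar>f t\<bar> \<le> f 0" for t
      using Cauchy_Schwarz_ineq2[of "W t x" x] by (simp add: f_def W0 normW dot_square_norm power2_eq_square)
    ultimately obtain n :: int where n: "integral {-pi..pi} (\<lambda>t. cos (of_int n * t) * f t) \<noteq> 0"
      by (rule exists_nonzero_cos_coefficient)
    \<comment> \<open>The coefficients at n and - n add up to twice a cosine integral, whose inner
      product with x is the nonzero number found above, doubled.\<close>
    have "z n + z (- n) = integral {-pi..pi} (\<lambda>t. h n t + h (- n) t)"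
      unfolding z_def by (rule integral_add[OF int_h int_h, symmetric])
    also have "(\<lambda>t. h n t + h (- n) t) = (\<lambda>t. (2 * cos (of_int n * t)) *\<^sub>R W t x)"
    proof
      fix t show "h n t + h (- n) t = (2 * cos (of_int n * t)) *\<^sub>R W t x"
        by (simp add: h_def R_def scaleR_2[symmetric])
    qed
    finally have "inner (z n + z (- n)) x
        = inner (integral {-pi..pi} (\<lambda>t. (2 * cos (of_int n * t)) *\<^sub>R W t x)) x" by simp
    also have "\<dots> = integral {-pi..pi} ((\<lambda>v. inner v x) \<circ> (\<lambda>t. (2 * cos (of_int n * t)) *\<^sub>R W t x))"
    proof (rule integral_linear[OF _ bounded_linear_inner_left, symmetric])
      have "continuous_on {-pi..pi} (\<lambda>t. W t x)" by (rule continuous_on_subset[OF contW]) simp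
      thus "(\<lambda>t. (2 * cos (of_int n * t)) *\<^sub>R W t x) integrable_on {-pi..pi}"
        by (intro integrable_continuous_interval continuous_intros)
    qed
    also have "\<dots> = integral {-pi..pi} (\<lambda>t. 2 * (cos (of_int n * t) * f t))"
      by (simp add: o_def f_def mult.assoc)
    also have "\<dots> = 2 * integral {-pi..pi} (\<lambda>t. cos (of_int n * t) * f t)"
      by (rule integral_mult_right)
    finally have "z n + z (- n) \<noteq> 0" using n by auto
    thus ?thesis by (metis add.right_neutral)
  qed
  then obtain m where m: "z m \<noteq> 0" ..
  show thesis
  proof (rule that[of "z m" "D m"])
    show "z m \<in> S" using zN N(2) by blast
    show "linear (D m t)" for t by (rule linearI) (simp_all add: D_def lin_simps)
    show "inner (D m t x) (D m t y) = inner x y" for t x y by (simp add: D_def R_inner innerC)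
    show "D m s (D m t x) = D m (s + t) x" for s t x
      by (simp add: D_def CR R_R CC add_divide_distrib algebra_simps)
    show "D m 0 x = x" for x by (simp add: D_def C0)
    show "V g (D m t x) = D m t (V g x)" if "g \<in> SL2t" for g t x using that by (simp add: D_def V_R VC)
    show "I (D m t x) = D m t (I x)" for t x by (simp add: D_def R_I[symmetric] IC)
    show "K t (z m) = D m t (z m)" for t
    proof -
      have "R (- \<beta> * t) (C (t / (2 * pi)) (W t (z m))) = K t (z m)"
        by (simp add: W_def KC[symmetric] CR K_R[symmetric] CC R_R C0)
      thus ?thesis by (simp add: W_z D_def CR R_R algebra_simps)
    qed
  qed (fact m)
qed

text \<open>The real and imaginary parts of the conjugation condition: \<open>inner (I u) z\<close>
  is, up to sign, the imaginary part of the complex inner product.\<close>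

definition tau_symmetric :: "'h \<Rightarrow> bool" where
  "tau_symmetric z \<longleftrightarrow> (\<forall>g\<in>SL2t. inner (V (tauG g) z) z = inner (V g z) z \<and>
     inner (I (V (tauG g) z)) z = - inner (I (V g z)) z)"

lemma exists_tau_symmetric:
  assumes S: "inv_subspace S" and ne: "y \<in> S" "y \<noteq> 0"
  obtains z where "z \<in> S" "z \<noteq> 0" "tau_symmetric z"
proof -
  obtain z and D :: "real \<Rightarrow> 'h \<Rightarrow> 'h" where z: "z \<in> S" "z \<noteq> 0"
    and linD: "\<And>t. linear (D t)" and innerD: "\<And>t x y. inner (D t x) (D t y) = inner x y"
    and DD: "\<And>s t x. D s (D t x) = D (s + t) x" and D0: "\<And>x. D 0 x = x"
    and VD: "\<And>t g x. g \<in> SL2t \<Longrightarrow> V g (D t x) = D t (V g x)" and ID: "\<And>t x. I (D t x) = D t (I x)"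
    and KD: "\<And>t. K t z = D t z"
    by (rule exists_torus_quasi_eigenvector[OF S ne]) (rule that)
  have D_adj: "inner (D t x) y = inner x (D (- t) y)" for t x y
    using innerD[of "- t" "D t x" y] by (simp add: DD D0)
  have KD': "K s (D t x) = D t (K s x)" for s t x by (simp add: K_def VD)
  \<comment> \<open>Since D commutes with the representation, the two angles enter only through
    their sum.\<close>
  have KAK: "inner (K s (V (diagA r) (K t z))) z = inner (V (diagA r) z) (D (- (s + t)) z)"
    "inner (I (K s (V (diagA r) (K t z)))) z = inner (I (V (diagA r) z)) (D (- (s + t)) z)"
    if r: "r > 0" for s t r
    using r by (simp_all add: KD K_I[symmetric] K_adj VD ID D_adj DD add.commute)
  have conj: "V (diagA (1 / r)) x = K (pi / 2) (V (diagA r) (K (- pi / 2) x))" if "r > 0" for r x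
    using V_KAK[OF that, of "pi / 2" "- pi / 2" x] rotK_diagA_conj[OF that] by simp
  \<comment> \<open>The quarter turns contribute D (pi/2) and D (- pi/2), which cancel because D
    passes through V a.\<close>
  have flip: "inner (V (diagA (1 / r)) z) (D s z) = inner (V (diagA r) z) (D s z)"
    "inner (I (V (diagA (1 / r)) z)) (D s z) = inner (I (V (diagA r) z)) (D s z)" if r: "r > 0" for r s
    using r by (simp_all add: conj KD K_I[symmetric] K_adj KD' VD ID D_adj DD)
  \<comment> \<open>Passing to the adjoint exchanges the two vectors and replaces a by its inverse;
    \<open>flip\<close> restores a. In \<open>odd\<close> the same exchange costs the sign of the
    skew operator I.\<close>
  have even: "inner (V (diagA r) z) (D (- s) z) = inner (V (diagA r) z) (D s z)" if r: "r > 0" for r s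
  proof -
    have "inner (V (diagA r) z) (D (- s) z) = inner (V (diagA r) (D s z)) z"
      using r by (simp add: VD D_adj)
    also have "\<dots> = inner (D s z) (V (diagA (1 / r)) z)" by (rule V_diagA_adj[OF r])
    also have "\<dots> = inner (V (diagA r) z) (D s z)" unfolding flip(1)[OF r, symmetric] by (rule inner_commute)
    finally show ?thesis .
  qed
  have odd: "inner (I (V (diagA r) z)) (D (- s) z) = - inner (I (V (diagA r) z)) (D s z)" if r: "r > 0" for r s
  proof -
    have "inner (I (V (diagA r) z)) (D (- s) z) = inner (V (diagA r) (I (D s z))) z"
      using r by (simp add: V_I VD ID D_adj)
    also have "\<dots> = inner (I (D s z)) (V (diagA (1 / r)) z)" by (rule V_diagA_adj[OF r])
    also have "\<dots> = - inner (D s z) (I (V (diagA (1 / r)) z))" by (rule I_skew)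
    also have "inner (D s z) (I (V (diagA (1 / r)) z)) = inner (I (V (diagA r) z)) (D s z)"
      unfolding flip(2)[OF r, symmetric] by (rule inner_commute)
    finally show ?thesis .
  qed
  have "tau_symmetric z" unfolding tau_symmetric_def
  proof
    fix g assume "g \<in> SL2t"
    then obtain s r t where r: "r > 0" and g: "g = sl2t_mult (rotK s) (sl2t_mult (diagA r) (rotK t))"
      using SL2t_KAK by blast
    have tg: "tauG g = sl2t_mult (rotK (- s)) (sl2t_mult (diagA r) (rotK (- t)))"
      unfolding g using r by (simp add: tauG_mult)
    show "inner (V (tauG g) z) z = inner (V g z) z \<and> inner (I (V (tauG g) z)) z = - inner (I (V g z)) z"
      unfolding tg unfolding g V_KAK[OF r] KAK[OF r]
      using even[OF r, of "s + t"] odd[OF r, of "s + t"] by (simp add: add.commute)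
  qed
  with z show thesis using that by blast
qed

section \<open>Orthogonal cyclic subspaces and the conjugation\<close>

lemma inner_V_V:
  assumes g: "g \<in> SL2t" and h: "h \<in> SL2t"
  obtains k where "k \<in> SL2t" "\<And>x y. inner (V g x) (V h y) = inner (V k x) y"
    "\<And>x y. inner (V (tauG g) x) (V (tauG h) y) = inner (V (tauG k) x) y"
proof -
  obtain h' where h': "h' \<in> SL2t" "\<And>x y. inner (V h x) y = inner x (V h' y)"
    "\<And>x y. inner (V (tauG h) x) y = inner x (V (tauG h') y)"
    by (rule V_adjoint[OF h]) (rule that)
  show thesis
  proof (rule that[of "sl2t_mult h' g"])
    show "inner (V g x) (V h y) = inner (V (sl2t_mult h' g) x) y" for x y
      using h'(2)[of y "V g x"] g h'(1) by (simp add: V_mult inner_commute)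
    show "inner (V (tauG g) x) (V (tauG h) y) = inner (V (tauG (sl2t_mult h' g)) x) y" for x y
      using h'(3)[of y "V (tauG g) x"] g h'(1) by (simp add: V_mult tauG_mult inner_commute)
  qed (use g h' in simp)
qed

text \<open>Distinct members generate orthogonal complex cyclic subspaces. The condition involves
  two members at a time, so it passes to unions of chains.\<close>

definition orthogonal_family :: "'h set \<Rightarrow> bool" where
  "orthogonal_family M \<longleftrightarrow> (\<forall>z\<in>M. z \<noteq> 0 \<and> tau_symmetric z) \<and>
     (\<forall>z\<in>M. \<forall>z'\<in>M. z \<noteq> z' \<longrightarrow> (\<forall>g\<in>SL2t. inner (V g z) z' = 0 \<and> inner (I (V g z)) z' = 0))"

text \<open>The flag adds the multiples by i, so that the real span is the complex one. Invalid
  indices get the harmless value 0, because \<open>isometry_extension\<close> takes families indexed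
  by a whole type.\<close>

definition orbit :: "'h set \<Rightarrow> sl2t \<times> 'h \<times> bool \<Rightarrow> 'h" where
  "orbit M = (\<lambda>(g, z, b). if g \<in> SL2t \<and> z \<in> M then (if b then I (V g z) else V g z) else 0)"

text \<open>The intended images of the vectors of \<open>orbit\<close> under the conjugation; the
  minus sign makes it antilinear.\<close>

definition orbit_conj :: "'h set \<Rightarrow> sl2t \<times> 'h \<times> bool \<Rightarrow> 'h" where
  "orbit_conj M = (\<lambda>(g, z, b). if g \<in> SL2t \<and> z \<in> M
     then (if b then - I (V (tauG g) z) else V (tauG g) z) else 0)"

text \<open>If the orbits of a maximal family did not span a dense subspace, the orthogonal
  complement would be a nonzero invariant subspace, and a tau-symmetric vector in it would enlarge
  the family.\<close>

lemma exists_maximal_family: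
  obtains M where "orthogonal_family M" "closure (span (range (orbit M))) = UNIV"
proof -
  have "\<exists>M\<in>Collect orthogonal_family. \<forall>X\<in>Collect orthogonal_family. M \<subseteq> X \<longrightarrow> X = M"
  proof (rule Zorn_Lemma, intro ballI)
    fix C assume C: "C \<in> chains (Collect orthogonal_family)"
    hence fam: "\<And>X. X \<in> C \<Longrightarrow> orthogonal_family X"
      and chain: "\<And>X Y. X \<in> C \<Longrightarrow> Y \<in> C \<Longrightarrow> X \<subseteq> Y \<or> Y \<subseteq> X"
      by (auto simp: chains_def chain_subset_def)
    have "orthogonal_family (\<Union>C)" unfolding orthogonal_family_def
    proof (intro conjI ballI impI)
      fix z assume "z \<in> \<Union>C"
      then obtain X where "X \<in> C" "z \<in> X" by blast
      thus "z \<noteq> 0" "tau_symmetric z" using fam[of X] by (auto simp: orthogonal_family_def)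
    next
      fix z z' g assume z: "z \<in> \<Union>C" "z' \<in> \<Union>C" "z \<noteq> z'" and g: "g \<in> SL2t"
      then obtain X where X: "X \<in> C" "z \<in> X" "z' \<in> X" using chain by blast
      show "inner (V g z) z' = 0" "inner (I (V g z)) z' = 0"
        using fam[OF X(1)] X z g unfolding orthogonal_family_def by blast+
    qed
    thus "\<Union>C \<in> Collect orthogonal_family" by simp
  qed
  then obtain M where M: "orthogonal_family M" and max: "\<And>X. orthogonal_family X \<Longrightarrow> M \<subseteq> X \<Longrightarrow> X = M"
    by blast
  have "closure (span (range (orbit M))) = UNIV"
  proof (rule ccontr)
    assume "closure (span (range (orbit M))) \<noteq> UNIV"
    then obtain x where x: "x \<notin> closure (span (range (orbit M)))" by blast
    have sub: "subspace (closure (span (range (orbit M))))"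
      by (rule closure_subspace_normed[OF subspace_span])
    obtain p where p: "p \<in> closure (span (range (orbit M)))"
      "\<And>y. y \<in> closure (span (range (orbit M))) \<Longrightarrow> inner (x - p) y = 0"
      using closed_subspace_nearest[OF sub closed_closure] by metis
    define S where "S = {y. \<forall>i. inner (orbit M i) y = 0}"
    have xp: "x - p \<in> S"
    proof -
      have "orbit M i \<in> closure (span (range (orbit M)))" for i
        by (rule subsetD[OF closure_subset]) (auto intro: span_base)
      from p(2)[OF this] show ?thesis by (simp add: S_def inner_commute)
    qed
    have S_eq: "y \<in> S \<longleftrightarrow> (\<forall>g\<in>SL2t. \<forall>z\<in>M. inner (V g z) y = 0 \<and> inner (I (V g z)) y = 0)" for y
    proof
      assume "y \<in> S"
      hence o: "inner (orbit M i) y = 0" for i unfolding S_def by blast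
      show "\<forall>g\<in>SL2t. \<forall>z\<in>M. inner (V g z) y = 0 \<and> inner (I (V g z)) y = 0"
      proof (intro ballI)
        fix g z assume "g \<in> SL2t" "z \<in> M"
        thus "inner (V g z) y = 0 \<and> inner (I (V g z)) y = 0"
          using o[of "(g, z, False)"] o[of "(g, z, True)"] by (simp add: orbit_def)
      qed
    next
      assume a: "\<forall>g\<in>SL2t. \<forall>z\<in>M. inner (V g z) y = 0 \<and> inner (I (V g z)) y = 0"
      have "inner (orbit M i) y = 0" for i
      proof -
        obtain g z b where "i = (g, z, b)" by (rule prod_cases3)
        thus ?thesis using a by (simp add: orbit_def)
      qed
      thus "y \<in> S" unfolding S_def by blast
    qed
    have "inv_subspace S" unfolding inv_subspace_def
    proof (intro conjI ballI)
      have "S = (\<Inter>i. {y. inner (orbit M i) y = 0})" by (auto simp: S_def)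
      moreover have "closed (\<Inter>i. {y. inner (orbit M i) y = 0})"
        by (intro closed_INT ballI closed_Collect_eq continuous_intros)
      ultimately show "closed S" by simp
      show "subspace S" by (auto simp: subspace_def S_def inner_add_right)
      show "I y \<in> S" if "y \<in> S" for y
        using that unfolding S_eq by (auto simp: I_skew)
      show "V h y \<in> S" if h: "h \<in> SL2t" and y: "y \<in> S" for h y
        unfolding S_eq
      proof (intro ballI)
        fix g z assume g: "g \<in> SL2t" and z: "z \<in> M"
        obtain k where k: "k \<in> SL2t" "\<And>x y. inner (V g x) (V h y) = inner (V k x) y"
          by (rule inner_V_V[OF g h]) (rule that)
        show "inner (V g z) (V h y) = 0 \<and> inner (I (V g z)) (V h y) = 0"
          using k(2)[of z y] k(2)[of "I z" y] y z k(1) by (simp add: S_eq V_I[symmetric] g)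
      qed
    qed
    moreover have "x - p \<noteq> 0" using x p(1) by auto
    ultimately obtain z where z: "z \<in> S" "z \<noteq> 0" "tau_symmetric z"
      using exists_tau_symmetric[OF _ xp] by metis
    have zM: "z \<notin> M" 
    proof
      assume "z \<in> M"
      hence "inner (V sl2t_one z) z = 0" using z(1) sl2t_one_in unfolding S_eq by blast
      thus False using z(2) by simp
    qed
    have "orthogonal_family (insert z M)"
    proof -
      have 1: "inner (V g z') z = 0 \<and> inner (I (V g z')) z = 0" if "z' \<in> M" "g \<in> SL2t" for g z'
        using z(1) that unfolding S_eq by blast
      \<comment> \<open>Membership in S makes z orthogonal to the orbits of M; moving V g to the
        other side gives the converse relation.\<close>
      have 2: "inner (V g z) z' = 0 \<and> inner (I (V g z)) z' = 0" if z': "z' \<in> M" and g: "g \<in> SL2t" for g z'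
      proof -
        obtain h where h: "h \<in> SL2t" "\<And>x y. inner (V g x) y = inner x (V h y)"
          by (rule V_adjoint[OF g]) (rule that)
        have "inner z (V h z') = 0" "inner z (I (V h z')) = 0"
          using 1[OF z' h(1)] by (auto simp: inner_commute)
        thus ?thesis using h g by (simp add: V_I[symmetric] I_skew)
      qed
      show ?thesis using M z(2,3) 1 2 unfolding orthogonal_family_def by blast
    qed
    from max[OF this] zM show False by blast
  qed
  with M show thesis by (rule that)
qed

text \<open>Both sides reduce to coefficients at k = h^-1 g and at \<open>tauG k\<close>. For a
  common generator they are related by tau-symmetry; for distinct generators they vanish.\<close>

lemma orbit_inner:
  assumes M: "orthogonal_family M"
  shows "inner (orbit M p) (orbit M q) = inner (orbit_conj M p) (orbit_conj M q)"
proof -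
  obtain g z b h z' b' where pq: "p = (g, z, b)" "q = (h, z', b')" by (metis surj_pair)
  show ?thesis
  proof (cases "g \<in> SL2t \<and> z \<in> M \<and> h \<in> SL2t \<and> z' \<in> M")
    case True
    hence g: "g \<in> SL2t" "tauG g \<in> SL2t" and h: "h \<in> SL2t" "tauG h \<in> SL2t" and z: "z \<in> M" "z' \<in> M" by auto
    obtain k where k: "k \<in> SL2t" "\<And>x y. inner (V g x) (V h y) = inner (V k x) y"
      "\<And>x y. inner (V (tauG g) x) (V (tauG h) y) = inner (V (tauG k) x) y"
      by (rule inner_V_V[OF g(1) h(1)]) (rule that)
    have tk: "tauG k \<in> SL2t" using k(1) by simp
    have "inner (V (tauG k) z) z' = inner (V k z) z' \<and> inner (I (V (tauG k) z)) z' = - inner (I (V k z)) z'"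
    proof (cases "z = z'")
      case True
      thus ?thesis using M z k(1) by (auto simp: orthogonal_family_def tau_symmetric_def)
    next
      case False
      hence "inner (V l z) z' = 0" "inner (I (V l z)) z' = 0" if "l \<in> SL2t" for l
        using M z that by (auto simp: orthogonal_family_def)
      thus ?thesis using k(1) tk by simp
    qed
    hence a: "inner (V (tauG g) z) (V (tauG h) z') = inner (V g z) (V h z')"
      "inner (I (V (tauG g) z)) (V (tauG h) z') = - inner (I (V g z)) (V h z')"
      using k(2,3)[of z z'] k(2,3)[of "I z" z'] g k(1) tk by (simp_all add: V_I)
    have "inner (V (tauG g) z) (I (V (tauG h) z')) = - inner (V g z) (I (V h z'))"
      using a(2) by (simp add: I_skew)
    with a True show ?thesis by (simp add: pq orbit_def orbit_conj_def)
  qed (auto simp: pq orbit_def orbit_conj_def)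
qed

text \<open>All the identities are between bounded linear maps, so orbit vectors suffice, and there
  they come from \<open>tauG\<close> being an involutive homomorphism.\<close>

lemma exists_conjugation:
  obtains J where "linear J" "\<And>x y. inner (J x) (J y) = inner x y" "\<And>x. J (J x) = x"
    "\<And>x. J (I x) = - I (J x)" "\<And>g x. g \<in> SL2t \<Longrightarrow> J (V g x) = V (tauG g) (J x)"
proof -
  obtain M where M: "orthogonal_family M" and dense: "closure (span (range (orbit M))) = UNIV"
    by (rule exists_maximal_family)
  obtain J where lin: "linear J" and inner: "\<And>x y. inner (J x) (J y) = inner x y"
    and J: "\<And>p. J (orbit M p) = orbit_conj M p"
    using isometry_extension[OF orbit_inner[OF M] dense] by metis
  have bl: "bounded_linear J"
    by (rule bounded_linear_isometry[OF lin]) (simp add: norm_eq_sqrt_inner inner)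
  have J1: "J (V g z) = V (tauG g) z" "J (I (V g z)) = - I (V (tauG g) z)" if "g \<in> SL2t" "z \<in> M" for g z
    using J[of "(g, z, False)"] J[of "(g, z, True)"] that by (auto simp: orbit_def orbit_conj_def)
  have dense_eq: "A x = B x" if "bounded_linear A" "bounded_linear B"
    "\<And>g z. g \<in> SL2t \<Longrightarrow> z \<in> M \<Longrightarrow> A (V g z) = B (V g z)"
    "\<And>g z. g \<in> SL2t \<Longrightarrow> z \<in> M \<Longrightarrow> A (I (V g z)) = B (I (V g z))" for A B :: "'h \<Rightarrow> 'h" and x
  proof (rule linear_eq_on_dense[OF that(1,2) dense])
    fix p show "A (orbit M p) = B (orbit M p)"
      using that(3,4) linear_0[OF bounded_linear.linear[OF that(1)]] linear_0[OF bounded_linear.linear[OF that(2)]]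
      by (cases p) (auto simp: orbit_def)
  qed
  note Jneg = linear_neg[OF lin]
  have "J (J x) = x" for x
    by (rule dense_eq[of "\<lambda>x. J (J x)" "\<lambda>x. x"])
       (auto simp: J1 Jneg bounded_linear_compose[OF bl bl])
  moreover have "J (I x) = - I (J x)" for x
    by (rule dense_eq[of "\<lambda>x. J (I x)" "\<lambda>x. - I (J x)"])
       (auto simp: J1 Jneg bounded_linear_compose[OF bl I_bl]
         intro!: bounded_linear_minus bounded_linear_compose[OF I_bl bl])
  moreover have "J (V h x) = V (tauG h) (J x)" if h: "h \<in> SL2t" for h x
  proof (rule dense_eq[of "\<lambda>x. J (V h x)" "\<lambda>x. V (tauG h) (J x)"])
    have h': "tauG h \<in> SL2t" using h by simp
    show "bounded_linear (\<lambda>x. J (V h x))" by (rule bounded_linear_compose[OF bl V_bl[OF h]])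
    show "bounded_linear (\<lambda>x. V (tauG h) (J x))" by (rule bounded_linear_compose[OF V_bl[OF h'] bl])
    fix g z assume gz: "g \<in> SL2t" "z \<in> M"
    show eq: "J (V h (V g z)) = V (tauG h) (J (V g z))"
      using gz h h' by (simp add: V_mult[symmetric] J1 tauG_mult)
    have "J (V h (I (V g z))) = J (I (V (sl2t_mult h g) z))" using gz h by (simp add: V_mult V_I)
    also have "\<dots> = - I (V (tauG h) (V (tauG g) z))"
      using J1(2)[of "sl2t_mult h g" z] gz h h' by (simp add: tauG_mult V_mult)
    also have "\<dots> = V (tauG h) (J (I (V g z)))"
      using gz h' by (simp add: J1 V_I linear_neg[OF V_lin])
    finally show "J (V h (I (V g z))) = V (tauG h) (J (I (V g z)))" .
  qed
  ultimately show thesis using that[OF lin inner] by blast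
qed

lemma extends_to_GL2t: "\<exists>U. cont_au_rep_GL2t I U \<and> (\<forall>x\<in>SL2t. U (x, False) = V x)"
proof -
  obtain J where J: "linear J" "\<And>x y. inner (J x) (J y) = inner x y" "\<And>x. J (J x) = x"
    "\<And>x. J (I x) = - I (J x)" "\<And>g x. g \<in> SL2t \<Longrightarrow> J (V g x) = V (tauG g) (J x)"
    by (rule exists_conjugation) (rule that)
  \<comment> \<open>J is the image of tau_G; the relations J V(y) = V(tauG y) J and J J = 1 are
    exactly what the semidirect product demands.\<close>
  define U where "U = (\<lambda>(x, s). V x \<circ> (if s then J else id))"
  have surjJ: "surj J" using J(3) by (metis surjI)
  have "unitary_op I (U (x, False)) \<and> antiunitary_op I (U (x, True))" if x: "x \<in> SL2t" for x
    using comp_surj[OF surjJ V_surj[OF x]] linear_compose[OF J(1) V_lin[OF x]] x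
    by (simp add: U_def unitary_op_def antiunitary_op_def V_lin V_surj V_inner V_I J linear_neg[OF V_lin])
  moreover have "U (gl2t_mult p q) = U p \<circ> U q" if "p \<in> GL2t" "q \<in> GL2t" for p q
  proof -
    obtain x s y s' where pq: "p = (x, s)" "q = (y, s')" by (metis surj_pair)
    have xy: "x \<in> SL2t" "y \<in> SL2t" using that by (auto simp: pq GL2t_def)
    show ?thesis using xy by (auto simp: pq U_def V_mult J fun_eq_iff)
  qed
  moreover have "U gl2t_one = id" by (auto simp: U_def gl2t_one_def)
  moreover have "continuous_on SL2t (\<lambda>x. U (x, s) v)" for s v
    using V_cont[of v] V_cont[of "J v"] by (cases s) (auto simp: U_def)
  ultimately have "cont_au_rep_GL2t I U" unfolding cont_au_rep_GL2t_def by blast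
  moreover have "\<forall>x\<in>SL2t. U (x, False) = V x" by (simp add: U_def)
  ultimately show ?thesis by blast
qed

end

section \<open>Transfer to an arbitrary complete inner product space\<close>

text \<open>The sort \<open>{real_inner, complete_space}\<close> is not a subsort of \<open>banach\<close>, although every such type
  satisfies its axioms; a copy of the type does have the instance.\<close>

typedef (overloaded) 'a hilb = "UNIV :: 'a::{real_inner, complete_space} set"
  morphisms of_hilb to_hilb ..

setup_lifting type_definition_hilb

instantiation hilb :: ("{real_inner, complete_space}") real_vector
begin

lift_definition zero_hilb :: "'a hilb" is 0 .
lift_definition plus_hilb :: "'a hilb \<Rightarrow> 'a hilb \<Rightarrow> 'a hilb" is "(+)" .
lift_definition minus_hilb :: "'a hilb \<Rightarrow> 'a hilb \<Rightarrow> 'a hilb" is "(-)" .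
lift_definition uminus_hilb :: "'a hilb \<Rightarrow> 'a hilb" is uminus .
lift_definition scaleR_hilb :: "real \<Rightarrow> 'a hilb \<Rightarrow> 'a hilb" is scaleR .

instance
  by standard (transfer; simp add: algebra_simps)+

end

instantiation hilb :: ("{real_inner, complete_space}") real_inner
begin

lift_definition norm_hilb :: "'a hilb \<Rightarrow> real" is norm .
lift_definition inner_hilb :: "'a hilb \<Rightarrow> 'a hilb \<Rightarrow> real" is inner .
lift_definition sgn_hilb :: "'a hilb \<Rightarrow> 'a hilb" is sgn .
lift_definition dist_hilb :: "'a hilb \<Rightarrow> 'a hilb \<Rightarrow> real" is dist .

definition uniformity_hilb :: "('a hilb \<times> 'a hilb) filter" where
  "uniformity_hilb = (INF e\<in>{0<..}. principal {(x, y). dist x y < e})"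

definition open_hilb :: "'a hilb set \<Rightarrow> bool" where
  "open_hilb S = (\<forall>x\<in>S. \<forall>\<^sub>F (x', y) in uniformity. x' = x \<longrightarrow> y \<in> S)"

instance
proof
  fix x y z :: "'a hilb" and r :: real
  show "sgn x = x /\<^sub>R norm x" by transfer (simp add: sgn_div_norm)
  show "dist x y = norm (x - y)" by transfer (simp add: dist_norm)
  show "inner x y = inner y x" by transfer (rule inner_commute)
  show "inner (x + y) z = inner x z + inner y z" by transfer (rule inner_add_left)
  show "inner (r *\<^sub>R x) y = r * inner x y" "0 \<le> inner x x" "(inner x x = 0) = (x = 0)"
    by (transfer; simp)+
  show "norm x = sqrt (inner x x)" by transfer (rule norm_eq_sqrt_inner)
qed (simp_all add: uniformity_hilb_def open_hilb_def)

end

lemma dist_of_hilb: "dist (of_hilb x) (of_hilb y) = dist x y"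
  by (simp add: dist_hilb.rep_eq)

instance hilb :: ("{real_inner, complete_space}") banach
proof
  fix X :: "nat \<Rightarrow> 'a hilb" assume "Cauchy X"
  hence "Cauchy (\<lambda>n. of_hilb (X n))" by (simp add: Cauchy_def dist_of_hilb)
  then obtain L where "(\<lambda>n. of_hilb (X n)) \<longlonglongrightarrow> L" using Cauchy_convergent convergent_def by blast
  hence "X \<longlonglongrightarrow> to_hilb L"
    by (simp add: tendsto_iff dist_hilb.rep_eq to_hilb_inverse)
  thus "convergent X" by (auto simp: convergent_def)
qed

lemma of_to_hilb [simp]: "of_hilb (to_hilb x) = x" "to_hilb (of_hilb y) = y"
  by (simp_all add: to_hilb_inverse of_hilb_inverse)

lemma linear_of_hilb: "linear of_hilb" and linear_to_hilb: "linear to_hilb"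
  by (auto intro!: linearI simp: plus_hilb.rep_eq scaleR_hilb.rep_eq plus_hilb.abs_eq scaleR_hilb.abs_eq)

lemma inner_of_hilb [simp]: "inner (of_hilb x) (of_hilb y) = inner x y"
  by (simp add: inner_hilb.rep_eq)

lemma inner_to_hilb [simp]: "inner (to_hilb x) (to_hilb y) = inner x y"
  by (simp add: inner_hilb.rep_eq)

lemma continuous_on_of_hilb: "continuous_on A f \<Longrightarrow> continuous_on A (\<lambda>x. of_hilb (f x))"
  by (simp add: continuous_on_def tendsto_iff dist_of_hilb)

lemma continuous_on_to_hilb: "continuous_on A f \<Longrightarrow> continuous_on A (\<lambda>x. to_hilb (f x))"
  by (simp add: continuous_on_def tendsto_iff dist_of_hilb[symmetric])

lemma linear_to_of_hilb: "linear U \<Longrightarrow> linear (to_hilb \<circ> U \<circ> of_hilb)"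
  and linear_of_to_hilb: "linear U' \<Longrightarrow> linear (of_hilb \<circ> U' \<circ> to_hilb)"
  by (intro linear_compose linear_of_hilb linear_to_hilb; assumption)+

lemma surj_to_of_hilb: "surj U \<Longrightarrow> surj (to_hilb \<circ> U \<circ> of_hilb)"
  and surj_of_to_hilb: "surj U' \<Longrightarrow> surj (of_hilb \<circ> U' \<circ> to_hilb)"
  by (intro comp_surj surjI[of of_hilb to_hilb] surjI[of to_hilb of_hilb]; simp)+

lemma unitary_op_to_hilb:
  "unitary_op I U \<Longrightarrow> unitary_op (to_hilb \<circ> I \<circ> of_hilb) (to_hilb \<circ> U \<circ> of_hilb)"
  by (simp add: unitary_op_def linear_to_of_hilb surj_to_of_hilb[unfolded o_def])

lemma unitary_op_of_hilb:
  assumes "unitary_op (to_hilb \<circ> I \<circ> of_hilb) U"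
  shows "unitary_op I (of_hilb \<circ> U \<circ> to_hilb)"
proof -
  have "U (to_hilb (I x)) = to_hilb (I (of_hilb (U (to_hilb x))))" for x
    using assms by (auto simp: unitary_op_def dest: spec[of _ "to_hilb x"])
  thus ?thesis using assms
    by (simp add: unitary_op_def linear_of_to_hilb surj_of_to_hilb[unfolded o_def])
qed

lemma antiunitary_op_of_hilb:
  assumes "antiunitary_op (to_hilb \<circ> I \<circ> of_hilb) U"
  shows "antiunitary_op I (of_hilb \<circ> U \<circ> to_hilb)"
proof -
  have "U (to_hilb (I x)) = - to_hilb (I (of_hilb (U (to_hilb x))))" for x
    using assms by (auto simp: antiunitary_op_def dest: spec[of _ "to_hilb x"])
  thus ?thesis using assms
    by (simp add: antiunitary_op_def linear_of_to_hilb surj_of_to_hilb[unfolded o_def] linear_neg[OF linear_of_hilb])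
qed

theorem theorem4p25:
  fixes I :: "'h::{real_inner, complete_space} \<Rightarrow> 'h"
    and V :: "sl2t \<Rightarrow> 'h \<Rightarrow> 'h"
  assumes "complex_structure I"
    and "cont_unitary_rep_SL2t I V"
  shows "\<exists>U. cont_au_rep_GL2t I U \<and> (\<forall>x\<in>SL2t. U (x, False) = V x)"
proof -
  define I' where "I' = to_hilb \<circ> I \<circ> of_hilb"
  define V' where "V' x = to_hilb \<circ> V x \<circ> of_hilb" for x
  interpret sl2t_rep I' V'
  proof
    show "complex_structure I'"
      using assms(1)
      by (auto simp: complex_structure_def I'_def linear_to_of_hilb linear_neg[OF linear_to_hilb])
    show "cont_unitary_rep_SL2t I' V'"
      using assms(2)
      by (simp add: cont_unitary_rep_SL2t_def V'_def I'_def unitary_op_to_hilb fun_eq_iff continuous_on_to_hilb)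
  qed
  obtain U' where U': "cont_au_rep_GL2t I' U'" "\<forall>x\<in>SL2t. U' (x, False) = V' x"
    using extends_to_GL2t by blast
  define U where "U p = of_hilb \<circ> U' p \<circ> to_hilb" for p
  have "cont_au_rep_GL2t I U"
    using U'(1) unfolding cont_au_rep_GL2t_def U_def I'_def
    by (simp add: unitary_op_of_hilb antiunitary_op_of_hilb fun_eq_iff continuous_on_of_hilb)
  moreover have "\<forall>x\<in>SL2t. U (x, False) = V x" using U'(2) by (auto simp: U_def V'_def)
  ultimately show ?thesis by blast
qed

end
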